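(* Let $K$ be a perfect field and let $f$ be an irreducible polynomial of degree $n>2$ over $K$ with Galois group $G=\mathrm{Gal}(K_f/K)$, where $K_f$ is the splitting field of $f$. Let $k$ be a positive integer with $k<n$. Then $G$ is sharply $k$-transitive (on the roots of $f$) if and only if both of the following hold: (1) Every minimal generating set for $f$ over $K$ has cardinality $k$, and every subset of the set of roots of $f$ of cardinality $k$ is a minimal generating set for $f$ over $K$. Thus there are exactly $\binom{n}{k}$ many distinct minimal generating sets. (2) The length of any cluster tower of $f$ is $k$, and its degree sequence is $({}^nP_1,{}^nP_2,\dots,{}^nP_k)$. Thus there are exactly ${}^nP_{k-1}$ many distinct cluster towers.
   Context: Fix an algebraic closure $\bar K$ of $K$; $R\subset\bar K$ is the set of roots of $f$, and $K(B)$ is the field generated over $K$ by $B$. Here ${}^nP_j=n(n-1)\cdots(n-j+1)$, with ${}^nP_0=1$. Sharp $k$-transitivity: $G$ is sharply $k$-transitive if for any two ordered $k$-tuples of distinct roots $(\alpha_1,\dots,\alpha_k)$ and $(\beta_1,\dots,\beta_k)$ of $f$ there is a unique $\sigma\in G$ with $\sigma(\alpha_i)=\beta_i$ for all $1\le i\le k$. Minimal generating set: $B\subset R$ is a minimal generating set for $f$ over $K$ if $K(B)=K_f$ and $K(A)\neq K_f$ for every $A\subsetneq B$. Clusters: roots $\alpha,\beta\in R$ are equivalent if $K(\alpha)=K(\beta)$ (equality of subfields of $\bar K$); the equivalence classes are the root clusters of $f$, and $s_K(f)$ is their number. Cluster towers: for an ordering $(\beta_1,\dots,\beta_s)$, $s=s_K(f)$,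 of a complete set of representatives of the clusters, the chain $K\subseteq K(\beta_1)\subseteq K(\beta_1,\beta_2)\subseteq\dots\subseteq K(\beta_1,\dots,\beta_s)=K_f$ is a cluster tower of $f$. Its length is the number of strict inclusions. Its degree sequence is $([L_1:K],[L_2:K],\dots,[K_f:K])$, where $K\subsetneq L_1\subsetneq L_2\subsetneq\dots\subsetneq K_f$ are the distinct fields in the tower. Two cluster towers are equal if their fields are equal at each step, and distinct otherwise. *)

theory Defs
  imports "HOL-Algebra.Algebraic_Closure" "HOL-Algebra.Generated_Fields" "HOL-Algebra.Bij"
begin

text \<open>
  Throughout, \<open>L\<close> is an algebraic closure of its subfield \<open>K\<close>, i.e. \<open>algebraic_closure L K\<close>,
  and \<open>f\<close> is an element of \<open>carrier (K[X]\<^bsub>L\<^esub>)\<close>. All subfields are subsets of \<open>carrier L\<close>.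
\<close>

text \<open>
  A field is perfect if every irreducible polynomial over it is separable, i.e. has no multiple
  root in an algebraic closure.
\<close>

definition perfect_in :: "('a, 'b) ring_scheme \<Rightarrow> 'a set \<Rightarrow> bool" where
  "perfect_in L K \<longleftrightarrow>
     (\<forall>p \<in> carrier (K[X]\<^bsub>L\<^esub>). pirreducible\<^bsub>L\<^esub> K p \<longrightarrow>
        (\<forall>x \<in> carrier L. ring.alg_mult L p x \<le> 1))"

definition root_set :: "('a, 'b) ring_scheme \<Rightarrow> 'a list \<Rightarrow> 'a set" where
  "root_set L f = {x. ring.is_root L f x}"

definition adjoin :: "('a, 'b) ring_scheme \<Rightarrow> 'a set \<Rightarrow> 'a set \<Rightarrow> 'a set" where
  "adjoin L K B = generate_field L (K \<union> B)"

definition splitting_field :: "('a, 'b) ring_scheme \<Rightarrow> 'a set \<Rightarrow> 'a list \<Rightarrow> 'a set" where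
  "splitting_field L K f = adjoin L K (root_set L f)"

text \<open>
  Elements of \<^const>\<open>Bij\<close> are extensional, so that distinct elements of the carrier are distinct
  automorphisms of \<open>E\<close>.
\<close>

definition galois_group ::
    "('a, 'b) ring_scheme \<Rightarrow> 'a set \<Rightarrow> 'a set \<Rightarrow> ('a \<Rightarrow> 'a) monoid" where
  "galois_group L K E = (BijGroup E)
     \<lparr> carrier := {\<sigma> \<in> Bij E. \<sigma> \<in> ring_hom (L\<lparr>carrier := E\<rparr>) (L\<lparr>carrier := E\<rparr>) \<and>
                            (\<forall>x \<in> K. \<sigma> x = x)} \<rparr>"

definition sharply_transitive_on ::
    "nat \<Rightarrow> ('a \<Rightarrow> 'a) monoid \<Rightarrow> 'a set \<Rightarrow> bool" where
  "sharply_transitive_on k G R \<longleftrightarrow>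
     (\<forall>as bs. length as = k \<and> distinct as \<and> set as \<subseteq> R \<and>
              length bs = k \<and> distinct bs \<and> set bs \<subseteq> R \<longrightarrow>
        (\<exists>!\<sigma>. \<sigma> \<in> carrier G \<and> (\<forall>i<k. \<sigma> (as ! i) = bs ! i)))"

definition minimal_generating_set ::
    "('a, 'b) ring_scheme \<Rightarrow> 'a set \<Rightarrow> 'a list \<Rightarrow> 'a set \<Rightarrow> bool" where
  "minimal_generating_set L K f B \<longleftrightarrow>
     B \<subseteq> root_set L f \<and>
     adjoin L K B = splitting_field L K f \<and>
     (\<forall>A. A \<subset> B \<longrightarrow> adjoin L K A \<noteq> splitting_field L K f)"

definition root_clusters :: "('a, 'b) ring_scheme \<Rightarrow> 'a set \<Rightarrow> 'a list \<Rightarrow> 'a set set" where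
  "root_clusters L K f = root_set L f //
     {(x, y). x \<in> root_set L f \<and> y \<in> root_set L f \<and> adjoin L K {x} = adjoin L K {y}}"

definition cluster_ordering :: "('a, 'b) ring_scheme \<Rightarrow> 'a set \<Rightarrow> 'a list \<Rightarrow> 'a list \<Rightarrow> bool" where
  "cluster_ordering L K f bs \<longleftrightarrow>
     distinct bs \<and> set bs \<subseteq> root_set L f \<and>
     (\<forall>C \<in> root_clusters L K f. \<exists>!b. b \<in> set bs \<inter> C)"

text \<open>
  A tower is the list of its fields, repetitions included, starting with \<open>K\<close>; two towers are
  equal iff these lists are equal. Different orderings may give the same tower.
\<close>

definition tower_of :: "('a, 'b) ring_scheme \<Rightarrow> 'a set \<Rightarrow> 'a list \<Rightarrow> 'a set list" where
  "tower_of L K bs = K # map (\<lambda>i. adjoin L K (set (take i bs))) [1..<Suc (length bs)]"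

definition cluster_towers :: "('a, 'b) ring_scheme \<Rightarrow> 'a set \<Rightarrow> 'a list \<Rightarrow> 'a set list set" where
  "cluster_towers L K f = tower_of L K ` {bs. cluster_ordering L K f bs}"

definition tower_length :: "'a set list \<Rightarrow> nat" where
  "tower_length T = card {i. Suc i < length T \<and> T ! i \<subset> T ! Suc i}"

text \<open>
  Since a tower is increasing, \<^const>\<open>remdups_adj\<close> leaves exactly its distinct fields, in order;
  the first of them is \<open>K\<close>, whose degree is not part of the degree sequence.
\<close>

definition tower_degrees :: "('a, 'b) ring_scheme \<Rightarrow> 'a set \<Rightarrow> 'a set list \<Rightarrow> nat list" where
  "tower_degrees L K T = map (\<lambda>E. ring.dim L K E) (tl (remdups_adj T))"

text \<open>\<open>n(n-1)\<dots>(n-j+1)\<close>\<close>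

definition falling_factorial :: "nat \<Rightarrow> nat \<Rightarrow> nat" where
  "falling_factorial n j = (\<Prod>i<j. n - i)"

end

theory Submission
  imports Defs
begin

text \<open>
  Write \<open>R\<close> for the set of roots. Extending embeddings of intermediate fields shows that for
  \<open>B \<subseteq> R\<close> and a root \<open>x\<close>, the orbit of \<open>x\<close> under the pointwise stabiliser of \<open>B\<close> is the set of roots
  of the minimal polynomial of \<open>x\<close> over \<open>K(B)\<close>; as this polynomial is separable, \<open>[K(B, x) : K(B)]\<close> is
  the size of the orbit. Hence \<open>k\<close>-transitivity says that, for all \<open>j < k\<close>, the stabiliser of any \<open>j\<close>
  roots is transitive on the other \<open>n - j\<close> roots, i.e. that each of the first \<open>k\<close> adjunctions of a new
  root has the maximal degree \<open>n - j\<close>. Sharpness adds that any \<open>k\<close> roots generate the splitting field.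
  Both facts can be read off the degrees of the cluster towers, so condition (2) alone is already
  equivalent to sharp \<open>k\<close>-transitivity, and it implies (1).
\<close>

section \<open>Extending field homomorphisms\<close>

text \<open>A tower shows only its distinct fields, and an ordering lists one root per cluster. So a
  set \<open>B\<close> of j roots can head an ordering only if its roots generate pairwise different
  fields. Transitivity of the stabilisers of smaller sets provides this: for j \<ge> 2 the
  stabiliser of a root a is transitive on the other n - 1 \<ge> 2 roots, so K(a) contains no second
  root. In general K(B) contains no root outside \<open>B\<close> while at least two roots are left,
  because the stabiliser of \<open>B\<close> fixes every root in K(B). This fact makes the towers
  strict, bounds generating sets from below and lets a tower be decoded. A tower headed by
  \<open>B\<close> tells the degree of one new root over K(B) only. Orbits are equal or disjoint, so
  one orbit of size n - j is enough. The index k - 1 in the number of towers arises because the k-th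
  root leads to the full field whichever root it is. For k = 1 all roots form one cluster; for k
  \<ge> 2 every cluster is a single root.\<close>

lemma (in domain) eval_map_ring_hom:
  assumes E: "subfield E R" and s: "s \<in> ring_hom (R\<lparr>carrier := E\<rparr>) R" and y: "y \<in> carrier R"
  shows "(\<lambda>q. eval (map s q) y) \<in> ring_hom (E[X]) R"
proof -
  have Er: "subring E R" using subfieldE(1)[OF E] .
  interpret H: ring_hom_ring "R\<lparr>carrier := E\<rparr>" R s
    using s subring_is_ring[OF Er] ring_axioms by (intro ring_hom_ringI2)
  have sub: "set p \<subseteq> E" if "p \<in> carrier (E[X])" for p
    using that unfolding univ_poly_def polynomial_def by auto
  have mc: "set (map s p) \<subseteq> carrier R" if "set p \<subseteq> E" for p
    using that H.hom_closed by auto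
  show ?thesis
  proof (rule ring_hom_memI)
    fix p q assume p: "p \<in> carrier (E[X])" and q: "q \<in> carrier (E[X])"
    have pq: "poly_mult p q \<in> carrier (E[X])" "poly_add p q \<in> carrier (E[X])"
      using poly_mult_closed[OF Er] poly_add_closed[OF Er] p q by (auto simp: univ_poly_carrier[symmetric])
    \<comment> \<open>\<open>map s\<close> respects \<open>poly_mult\<close> only up to
      \<open>normalize\<close>; evaluation does not see the leading zeros that this removes.\<close>
    have "eval (map s (poly_mult p q)) y = eval (normalize (map s (poly_mult p q))) y"
      using eval_normalize[OF mc[OF sub[OF pq(1)]] y] by simp
    also have "\<dots> = eval (poly_mult (map s p) (map s q)) y"
      using H.poly_mult_hom'[of p q] sub[OF p] sub[OF q] poly_mult_consistent[OF Er] by simp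
    also have "\<dots> = eval (map s p) y \<otimes> eval (map s q) y"
      using eval_poly_mult[OF mc[OF sub[OF p]] mc[OF sub[OF q]] y] .
    finally show "eval (map s (p \<otimes>\<^bsub>E[X]\<^esub> q)) y = eval (map s p) y \<otimes> eval (map s q) y"
      by (simp add: univ_poly_mult)
    have "eval (map s (poly_add p q)) y = eval (normalize (map s (poly_add p q))) y"
      using eval_normalize[OF mc[OF sub[OF pq(2)]] y] by simp
    also have "\<dots> = eval (poly_add (map s p) (map s q)) y"
      using H.poly_add_hom'[of p q] sub[OF p] sub[OF q] poly_add_consistent[OF Er] by simp
    also have "\<dots> = eval (map s p) y \<oplus> eval (map s q) y"
      using eval_poly_add[OF mc[OF sub[OF p]] mc[OF sub[OF q]] y] .
    finally show "eval (map s (p \<oplus>\<^bsub>E[X]\<^esub> q)) y = eval (map s p) y \<oplus> eval (map s q) y"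
      by (simp add: univ_poly_add)
  next
    fix p assume p: "p \<in> carrier (E[X])"
    show "eval (map s p) y \<in> carrier R" using eval_in_carrier[OF mc[OF sub[OF p]] y] .
  next
    show "eval (map s \<one>\<^bsub>E [X]\<^esub>) y = \<one>"
      using H.hom_one y by (simp add: univ_poly_one)
  qed
qed

text \<open>Evaluation at \<open>x\<close> maps E[X] onto E(x) with kernel generated by the minimal
  polynomial. Applying \<open>s\<close> to the coefficients and evaluating at \<open>y\<close> kills
  that polynomial too, hence factors through E(x).\<close>

lemma (in domain) hom_extends_to_simple_extension:
  assumes E: "subfield E R" and s: "s \<in> ring_hom (R\<lparr>carrier := E\<rparr>) R"
    and x: "x \<in> carrier R" "(algebraic over E) x"
    and y: "y \<in> carrier R" "eval (map s (Irr E x)) y = \<zero>"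
  obtains t where "t \<in> ring_hom (R\<lparr>carrier := simple_extension E x\<rparr>) R"
    and "\<And>a. a \<in> E \<Longrightarrow> t a = s a" and "t x = y"
proof -
  have Er: "subring E R" using subfieldE(1)[OF E] .
  interpret H: ring_hom_ring "R\<lparr>carrier := E\<rparr>" R s
    using s subring_is_ring[OF Er] ring_axioms by (intro ring_hom_ringI2)
  let ?P = "\<lambda>q. eval (map s q) y"
  let ?V = "\<lambda>q. eval q x"
  interpret UP: domain "E[X]" using univ_poly_is_domain[OF Er] .
  interpret P: ring_hom_ring "E[X]" R ?P
    using eval_map_ring_hom[OF E s y(1)] UP.ring_axioms ring_axioms by (intro ring_hom_ringI2)
  interpret V: ring_hom_ring "E[X]" R ?V
    using eval_ring_hom[OF Er x(1)] .
  note I = IrrE[OF E x]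
  have ker: "?P q = \<zero>" if q: "q \<in> carrier (E[X])" "?V q = \<zero>" for q
  proof -
    have "Irr E x divides\<^bsub>E[X]\<^esub> q"
      using Irr_minimal[OF E x q] pdivides_iff_shell[OF E I(1) q(1)] by simp
    then obtain r where "r \<in> carrier (E[X])" "q = Irr E x \<otimes>\<^bsub>E[X]\<^esub> r"
      unfolding factor_def by auto
    then show ?thesis using P.hom_mult[OF I(1)] y(2) P.hom_closed by simp
  qed
  have wd: "?P p = ?P q" if "p \<in> carrier (E[X])" "q \<in> carrier (E[X])" "?V p = ?V q" for p q
  proof -
    have "?V (p \<ominus>\<^bsub>E[X]\<^esub> q) = \<zero>"
      using that V.hom_add[of p "\<ominus>\<^bsub>E[X]\<^esub> q"] V.hom_a_inv[of q] UP.minus_eq[of p q] V.hom_closed[of q]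
      by (simp add: r_neg)
    then have "?P (p \<ominus>\<^bsub>E[X]\<^esub> q) = \<zero>" using ker[of "p \<ominus>\<^bsub>E[X]\<^esub> q"] that by simp
    then have "?P p \<oplus> \<ominus> ?P q = \<zero>"
      using that P.hom_add[of p "\<ominus>\<^bsub>E[X]\<^esub> q"] P.hom_a_inv[of q] UP.minus_eq[of p q] by simp
    then show ?thesis using that P.hom_closed
      by (metis minus_equality minus_minus a_inv_closed)
  qed
  \<comment> \<open>\<open>t\<close> reads an element of E(x) through some polynomial that
    represents it, and \<open>wd\<close> makes the choice immaterial. Its values outside E(x) are
    arbitrary.\<close>
  define t where "t a = ?P (SOME q. q \<in> carrier (E[X]) \<and> ?V q = a)" for a
  have tV: "t (?V q) = ?P q" if q: "q \<in> carrier (E[X])" for q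
  proof -
    have "\<exists>r. r \<in> carrier (E[X]) \<and> ?V r = ?V q" using q by blast
    from someI_ex[OF this] show ?thesis unfolding t_def using wd q by blast
  qed
  have img: "simple_extension E x = ?V ` carrier (E[X])"
    using simple_extension_as_eval_img[OF subringE(1)[OF Er] x(1)] .
  show thesis
  proof
    show "t \<in> ring_hom (R\<lparr>carrier := simple_extension E x\<rparr>) R"
    proof (rule ring_hom_memI)
      fix a b assume "a \<in> carrier (R\<lparr>carrier := simple_extension E x\<rparr>)" "b \<in> carrier (R\<lparr>carrier := simple_extension E x\<rparr>)"
      then obtain p q where p: "p \<in> carrier (E[X])" "a = ?V p" and q: "q \<in> carrier (E[X])" "b = ?V q"
        unfolding img by auto
      show "t (a \<otimes>\<^bsub>R\<lparr>carrier := simple_extension E x\<rparr>\<^esub> b) = t a \<otimes> t b"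
        using tV[of "p \<otimes>\<^bsub>E[X]\<^esub> q"] tV[OF p(1)] tV[OF q(1)] p q V.hom_mult[of p q] P.hom_mult[of p q] by simp
      show "t (a \<oplus>\<^bsub>R\<lparr>carrier := simple_extension E x\<rparr>\<^esub> b) = t a \<oplus> t b"
        using tV[of "p \<oplus>\<^bsub>E[X]\<^esub> q"] tV[OF p(1)] tV[OF q(1)] p q V.hom_add[of p q] P.hom_add[of p q] by simp
    next
      fix a assume "a \<in> carrier (R\<lparr>carrier := simple_extension E x\<rparr>)"
      then obtain p where p: "p \<in> carrier (E[X])" "a = ?V p" unfolding img by auto
      then show "t a \<in> carrier R" using tV P.hom_closed by simp
    next
      show "t \<one>\<^bsub>R\<lparr>carrier := simple_extension E x\<rparr>\<^esub> = \<one>"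
        using tV[OF UP.one_closed] V.hom_one P.hom_one by simp
    qed
  next
    fix a assume a: "a \<in> E"
    have aR: "a \<in> carrier R" using a subringE(1)[OF Er] by auto
    \<comment> \<open>The constant polynomial is \<open>[a]\<close> only for nonzero
      \<open>a\<close>; zero is the empty list.\<close>
    show "t a = s a"
    proof (cases "a = \<zero>")
      case True
      then show ?thesis using tV[of "[]"] H.hom_zero by (simp add: univ_poly_zero_closed)
    next
      case False
      then have "[a] \<in> carrier (E[X])" using a by (auto simp: univ_poly_def polynomial_def)
      from tV[OF this] show ?thesis using aR y H.hom_closed[of a] a by simp
    qed
  next
    have X: "X \<in> carrier (E[X])" using var_closed(1)[OF Er] .
    show "t x = y" using tV[OF X] x y H.hom_one H.hom_zero by (simp add: var_def)
  qed
qed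

lemma ring_hom_restrict_carrier:
  assumes s: "s \<in> ring_hom (R\<lparr>carrier := E\<rparr>) S" and sub: "F \<subseteq> E"
  shows "s \<in> ring_hom (R\<lparr>carrier := F\<rparr>) S"
  using ring_hom_memE[OF s] sub by (intro ring_hom_memI) (auto simp: subset_iff)

section \<open>Subfields obtained by adjoining sets\<close>

lemma (in field) adjoin_subfield:
  assumes "subfield E R" "B \<subseteq> carrier R"
  shows "subfield (adjoin R E B) R"
  unfolding adjoin_def using assms subfieldE(3)[OF assms(1)] by (intro generate_field_is_subfield) auto

lemma adjoin_incl: "E \<subseteq> adjoin R E B" "B \<subseteq> adjoin R E B"
  unfolding adjoin_def by (auto intro: generate_field.incl)

lemma (in field) adjoin_least:
  assumes "subfield F R" "E \<subseteq> F" "B \<subseteq> F"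
  shows "adjoin R E B \<subseteq> F"
  using generate_field_min_subfield1[of "E \<union> B" F] assms subfieldE(3)[OF assms(1)]
  unfolding adjoin_def by blast

text \<open>Algebraicity makes the ring of polynomial values at \<open>x\<close> a field already, so
  it contains everything that \<open>x\<close> and \<open>B\<close> generate.\<close>

lemma (in field) adjoin_insert:
  assumes E: "subfield E R" and B: "B \<subseteq> carrier R" and x: "x \<in> carrier R"
    and alg: "(algebraic over (adjoin R E B)) x"
  shows "adjoin R E (insert x B) = simple_extension (adjoin R E B) x"
proof
  note F = adjoin_subfield[OF E B]
  note Fr = subfieldE(1)[OF F]
  show "adjoin R E (insert x B) \<subseteq> simple_extension (adjoin R E B) x"
    using simple_extension_is_subfield[OF F x] alg simple_extension_mem[OF Fr x]
      simple_extension_incl[OF subfieldE(3)[OF F] x]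
      adjoin_incl[where E = E and B = B and R = R]
    by (intro adjoin_least) auto
  have F': "subfield (adjoin R E (insert x B)) R" using adjoin_subfield[OF E] B x by simp
  have "adjoin R E B \<subseteq> adjoin R E (insert x B)"
    using adjoin_incl[where E = E and B = "insert x B" and R = R] by (intro adjoin_least[OF F']) auto
  then show "simple_extension (adjoin R E B) x \<subseteq> adjoin R E (insert x B)"
    using adjoin_incl[where E = E and B = "insert x B" and R = R]
    by (intro simple_extension_subring_incl[OF subfieldE(1)[OF F']]) auto
qed

section \<open>Field homomorphisms on generated subfields\<close>

lemma (in field) subfield_hom_inv:
  assumes E: "subfield E R" and s: "s \<in> ring_hom (R\<lparr>carrier := E\<rparr>) R" and a: "a \<in> E" "a \<noteq> \<zero>"
  shows "s (inv a) = inv (s a)"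
proof -
  note i = subfield_m_inv[OF E, of a]
  have "s a \<otimes> s (inv a) = \<one>"
    using ring_hom_memE(2)[OF s, of a "inv a"] ring_hom_memE(4)[OF s] i a by simp
  moreover have "s a \<in> carrier R" "s (inv a) \<in> carrier R"
    using ring_hom_memE(1)[OF s] i a by simp_all
  ultimately show ?thesis using comm_inv_char by metis
qed

lemma (in field) subfield_hom_a_inv:
  assumes E: "subfield E R" and s: "s \<in> ring_hom (R\<lparr>carrier := E\<rparr>) R" and a: "a \<in> E"
  shows "s (\<ominus> a) = \<ominus> (s a)"
proof -
  have Er: "subring E R" using subfieldE(1)[OF E] .
  have aR: "a \<in> carrier R" "\<ominus> a \<in> E" using subringE(1,5)[OF Er] a by auto
  interpret H: ring_hom_ring "R\<lparr>carrier := E\<rparr>" R s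
    using s subring_is_ring[OF Er] ring_axioms by (intro ring_hom_ringI2)
  have "s \<zero> = \<zero>" using H.hom_zero by simp
  then have "s a \<oplus> s (\<ominus> a) = \<zero>"
    using H.hom_add[of a "\<ominus> a"] aR a by (simp add: r_neg)
  moreover have "s a \<in> carrier R" "s (\<ominus> a) \<in> carrier R" using H.hom_closed a aR by simp_all
  ultimately show ?thesis by (metis minus_equality minus_minus add.m_comm)
qed

lemma (in field) hom_eq_on_generate_field:
  assumes E: "subfield E R" and s: "s \<in> ring_hom (R\<lparr>carrier := E\<rparr>) R"
    and t: "t \<in> ring_hom (R\<lparr>carrier := E\<rparr>) R" and H: "H \<subseteq> E"
    and eq: "\<And>a. a \<in> H \<Longrightarrow> s a = t a" and a: "a \<in> generate_field R H"
  shows "s a = t a"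
proof -
  have HE: "generate_field R H \<subseteq> E"
    using generate_field_min_subfield1[OF _ E H] H subfieldE(3)[OF E] by blast
  from a show ?thesis
  proof induction
    case one
    then show ?case using ring_hom_memE(4)[OF s] ring_hom_memE(4)[OF t] by simp
  next
    case (incl h)
    then show ?case using eq by simp
  next
    case (a_inv h)
    then show ?case using subfield_hom_a_inv[OF E s] subfield_hom_a_inv[OF E t] HE by auto
  next
    case (m_inv h)
    then show ?case using subfield_hom_inv[OF E s] subfield_hom_inv[OF E t] HE by auto
  next
    case (eng_add h1 h2)
    then have "h1 \<in> E" "h2 \<in> E" using HE by auto
    then show ?case using ring_hom_memE(3)[OF s, of h1 h2] ring_hom_memE(3)[OF t, of h1 h2] eng_add.IH by simp
  next
    case (eng_mult h1 h2)
    then have "h1 \<in> E" "h2 \<in> E" using HE by auto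
    then show ?case using ring_hom_memE(2)[OF s, of h1 h2] ring_hom_memE(2)[OF t, of h1 h2] eng_mult.IH by simp
  qed
qed

text \<open>One inclusion is an induction over the generation of the field. For the other, the image
  is itself a subfield and contains the images of the generators.\<close>

lemma (in field) hom_image_generate_field:
  assumes E: "subfield E R" and s: "s \<in> ring_hom (R\<lparr>carrier := E\<rparr>) R" and H: "H \<subseteq> E"
  shows "s ` generate_field R H = generate_field R (s ` H)"
proof
  have HR: "H \<subseteq> carrier R" using H subfieldE(3)[OF E] by blast
  have HE: "generate_field R H \<subseteq> E"
    using generate_field_min_subfield1[OF HR E H] .
  have "s a \<in> generate_field R (s ` H)" if "a \<in> generate_field R H" for a
    using that
  proof induction
    case one
    then show ?case using ring_hom_memE(4)[OF s] by (simp add: generate_field.one)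
  next
    case (incl h)
    then show ?case by (simp add: generate_field.incl)
  next
    case (a_inv h)
    then have "h \<in> E" using HE by auto
    then show ?case using subfield_hom_a_inv[OF E s, of h] generate_field.a_inv[OF a_inv.IH] by simp
  next
    case (m_inv h)
    then have h: "h \<in> E" using HE by auto
    interpret Hh: ring_hom_ring "R\<lparr>carrier := E\<rparr>" R s
      using s subring_is_ring[OF subfieldE(1)[OF E]] ring_axioms by (intro ring_hom_ringI2)
    \<comment> \<open>Homomorphisms of fields are injective, so the inverse of \<open>s h\<close>
      may be formed.\<close>
    have "s h \<noteq> \<zero>"
      using non_trivial_field_hom_is_inj[OF s subfield_iff(2)[OF E] field_axioms]
        Hh.hom_zero h m_inv(2) subringE(2)[OF subfieldE(1)[OF E]] unfolding inj_on_def by auto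
    then show ?case using subfield_hom_inv[OF E s, of h] h m_inv generate_field.m_inv[OF m_inv.IH] by simp
  next
    case (eng_add h1 h2)
    then have "h1 \<in> E" "h2 \<in> E" using HE by auto
    then show ?case using ring_hom_memE(3)[OF s, of h1 h2] generate_field.eng_add[OF eng_add.IH] by simp
  next
    case (eng_mult h1 h2)
    then have "h1 \<in> E" "h2 \<in> E" using HE by auto
    then show ?case using ring_hom_memE(2)[OF s, of h1 h2] generate_field.eng_mult[OF eng_mult.IH] by simp
  qed
  then show "s ` generate_field R H \<subseteq> generate_field R (s ` H)" by blast
  let ?F = "generate_field R H"
  have F: "subfield ?F R" using generate_field_is_subfield[OF HR] .
  have "s \<in> ring_hom (R\<lparr>carrier := ?F\<rparr>) R"
    using ring_hom_restrict_carrier[OF s HE] .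
  then interpret F: ring_hom_ring "R\<lparr>carrier := ?F\<rparr>" R s
    using subring_is_ring[OF subfieldE(1)[OF F]] ring_axioms by (intro ring_hom_ringI2)
  have "subfield ?F (R\<lparr>carrier := ?F\<rparr>)"
    using field.carrier_is_subfield[OF subfield_iff(2)[OF F]] by simp
  from F.img_is_subfield(2)[OF this one_not_zero]
  have "subfield (s ` ?F) R" .
  moreover have "s ` H \<subseteq> s ` ?F" by (auto intro: generate_field.incl)
  ultimately show "generate_field R (s ` H) \<subseteq> s ` ?F"
    using generate_field_min_subfield1 subfieldE(3) by (metis subset_trans)
qed

section \<open>Conjugates over fields generated by roots\<close>

text \<open>Perfectness and irreducibility enter in the form of simple roots, which make the degree
  of each divisor of \<open>f\<close> equal to its number of roots.\<close>

locale separable_splitting = algebraic_closure L K for L (structure) and K +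
  fixes f
  assumes f_closed: "f \<in> carrier (K[X])" and f_nonzero: "f \<noteq> []"
    and simple_roots: "\<And>x. x \<in> carrier L \<Longrightarrow> alg_mult f x \<le> 1"
begin

abbreviation "R \<equiv> root_set L f"
abbreviation "N \<equiv> splitting_field L K f"
abbreviation "adj \<equiv> adjoin L K"
abbreviation "G \<equiv> carrier (galois_group L K N)"

lemma f_in_poly_ring: "f \<in> carrier (poly_ring L)"
  using carrier_polynomial_shell[OF subfieldE(1)[OF subfield_axioms] f_closed] .

lemma root_set_carrier: "R \<subseteq> carrier L"
  unfolding root_set_def is_root_def by auto

lemma mem_root_set_iff: "x \<in> R \<longleftrightarrow> x \<in> carrier L \<and> eval f x = \<zero>"
  unfolding root_set_def is_root_def using f_nonzero by auto

lemma algebraic_over_intermediate: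
  assumes "K \<subseteq> E" "x \<in> carrier L"
  shows "(algebraic over E) x"
  using algebraic_mono[OF assms(1)] algebraic_extension[OF assms(2)] .

lemma intermediate_poly:
  assumes "K \<subseteq> E" shows "f \<in> carrier (E[X])"
  using f_closed assms unfolding univ_poly_def polynomial_def by auto

lemma Irr_divides_f:
  assumes E: "subfield E L" "K \<subseteq> E" and x: "x \<in> R"
  shows "Irr E x pdivides f"
  using Irr_minimal[OF E(1) _ algebraic_over_intermediate[OF E(2)] intermediate_poly[OF E(2)]]
    x mem_root_set_iff by auto

text \<open>The roots of \<open>p\<close> form a submultiset of those of \<open>f\<close> and are
  therefore simple. As \<open>f\<close> splits over \<open>L\<close>, so does \<open>p\<close>, and
  its degree is the size of that multiset.\<close>

lemma card_roots_of_divisor: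
  assumes p: "p \<in> carrier (poly_ring L)" and d: "p pdivides f"
  shows "card {y. is_root p y} = degree p" and "{y. is_root p y} \<subseteq> R"
proof -
  have sub: "roots p \<subseteq># roots f" using pdivides_imp_roots_incl[OF p f_in_poly_ring f_nonzero d] .
  have le: "count (roots f) y \<le> 1" for y
    using simple_roots[of y] alg_mult_eq_count_roots[OF f_in_poly_ring]
      alg_mult_gt_zero_iff_is_root[OF f_in_poly_ring, of y] unfolding is_root_def
    by (cases "y \<in> carrier L") (auto simp: not_in_iff)
  have le': "count (roots p) y \<le> 1" for y
    using le[of y] mset_subset_eq_count[OF sub, of y] by linarith
  have st: "set_mset (roots p) = {y. is_root p y}"
    using roots_mem_iff_is_root[OF p] by auto
  have "roots p = mset_set (set_mset (roots p))"
  proof (rule multiset_eqI)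
    fix y
    show "count (roots p) y = count (mset_set (set_mset (roots p))) y"
      using le'[of y] count_greater_zero_iff[of "roots p" y]
      by (cases "y \<in># roots p") (auto simp: not_in_iff simp del: count_greater_zero_iff)
  qed
  then have "size (roots p) = card {y. is_root p y}" unfolding st by (metis size_mset_set)
  moreover have "splitted p"
    using pdivides_imp_splitted[OF p f_in_poly_ring f_nonzero roots_over_subfield[OF f_closed] d] .
  ultimately show "card {y. is_root p y} = degree p" unfolding splitted_def by simp
  show "{y. is_root p y} \<subseteq> R"
    using set_mset_mono[OF sub] st roots_mem_iff_is_root[OF f_in_poly_ring] unfolding root_set_def by auto
qed

lemma finite_root_set: "finite R"
  unfolding root_set_def using finite_number_of_roots[OF f_in_poly_ring] .

lemma card_root_set: "card R = degree f"
proof -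
  interpret UP: domain "poly_ring L" using univ_poly_is_domain[OF carrier_is_subring] .
  show ?thesis
    using card_roots_of_divisor(1)[OF f_in_poly_ring] UP.divides_refl[OF f_in_poly_ring]
    unfolding root_set_def pdivides_def by simp
qed

text \<open>The values lie in \<open>L\<close> rather than in \<open>E\<close>, because an
  intermediate field need not be mapped to itself; only on \<open>N\<close> do embeddings become
  automorphisms.\<close>

definition embedding :: "'a set \<Rightarrow> ('a \<Rightarrow> 'a) \<Rightarrow> bool" where
  "embedding E s \<longleftrightarrow> subfield E L \<and> K \<subseteq> E \<and> s \<in> ring_hom (L\<lparr>carrier := E\<rparr>) L \<and> (\<forall>a\<in>K. s a = a)"

lemma map_fixed_poly:
  assumes "\<forall>a\<in>E. s a = a" "p \<in> carrier (E[X])"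
  shows "map s p = p"
  using assms unfolding univ_poly_def polynomial_def by (auto intro!: map_idI)

text \<open>Apply \<open>s\<close> to a factorisation of \<open>f\<close> by the minimal polynomial.
  As \<open>s\<close> fixes the coefficients of \<open>f\<close>, the image of the minimal
  polynomial again divides \<open>f\<close>; it has positive degree, hence a root, and this root
  lies in \<open>R\<close>.\<close>

lemma conjugate_exists:
  assumes s: "embedding E s" and x: "x \<in> R"
  obtains y where "y \<in> R" "eval (map s (Irr E x)) y = \<zero>"
proof -
  have E: "subfield E L" "K \<subseteq> E" and sh: "s \<in> ring_hom (L\<lparr>carrier := E\<rparr>) L" and sK: "\<forall>a\<in>K. s a = a"
    using s unfolding embedding_def by auto
  have Er: "subring E L" using subfieldE(1)[OF E(1)] .
  have xL: "x \<in> carrier L" using x root_set_carrier by auto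
  note alg = algebraic_over_intermediate[OF E(2) xL]
  note I = IrrE[OF E(1) xL alg]
  interpret H: ring_hom_ring "L\<lparr>carrier := E\<rparr>" L s
    using sh subring_is_ring[OF Er] ring_axioms by (intro ring_hom_ringI2)
  have "Irr E x divides\<^bsub>E[X]\<^esub> f"
    using Irr_divides_f[OF E x] pdivides_iff_shell[OF E(1) I(1) intermediate_poly[OF E(2)]] by simp
  then obtain r where r: "r \<in> carrier (E[X])" and fr: "f = Irr E x \<otimes>\<^bsub>E[X]\<^esub> r"
    unfolding factor_def by auto
  have mp: "map s p \<in> carrier (poly_ring L)" if p: "p \<in> carrier (E[X])" for p
    using polynomial_hom[OF sh subfield_iff(2)[OF E(1)] field_axioms] p univ_poly_consistent[OF Er] by simp
  have sub: "set p \<subseteq> E" if "p \<in> carrier (E[X])" for p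
    using that unfolding univ_poly_def polynomial_def by auto
  have "poly_mult (map s (Irr E x)) (map s r) = normalize (map s f)"
    using H.poly_mult_hom'[of "Irr E x" r] sub[OF I(1)] sub[OF r] poly_mult_consistent[OF Er]
    by (simp add: fr univ_poly_mult)
  also have "map s f = f" using map_fixed_poly[OF sK f_closed] .
  also have "normalize f = f"
    using normalize_polynomial f_in_poly_ring by (simp add: univ_poly_carrier[symmetric])
  finally have "map s (Irr E x) pdivides f"
    unfolding pdivides_def factor_def using mp[OF r] by (auto simp: univ_poly_mult)
  note * = card_roots_of_divisor[OF mp[OF I(1)] this]
  have "degree (map s (Irr E x)) \<ge> 1" using pirreducible_degree[OF E(1) I(1,2)] by simp
  with *(1) have "{y. is_root (map s (Irr E x)) y} \<noteq> {}" by (metis card.empty not_one_le_zero)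
  then obtain y where "is_root (map s (Irr E x)) y" by blast
  with *(2) show ?thesis using that unfolding is_root_def by blast
qed

text \<open>The elements of \<open>A\<close> are adjoined one at a time, each being sent to some
  root of its transported minimal polynomial.\<close>

lemma embedding_extends:
  assumes s: "embedding E s" and A: "finite A" "A \<subseteq> R"
  obtains t where "embedding (adjoin L E A) t" "\<And>a. a \<in> E \<Longrightarrow> t a = s a"
proof -
  have E: "subfield E L" "K \<subseteq> E" using s unfolding embedding_def by auto
  have "\<exists>t. embedding (adjoin L E A) t \<and> (\<forall>a\<in>E. t a = s a)"
    using A
  proof (induction A)
    case empty
    have "adjoin L E {} = E"
      using adjoin_least[OF E(1) subset_refl, of "{}"] adjoin_incl(1)[of E L "{}"] by auto
    then show ?case using s by auto
  next
    case (insert x A)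
    then obtain t where t: "embedding (adjoin L E A) t" "\<forall>a\<in>E. t a = s a" by auto
    have xL: "x \<in> carrier L" and AL: "A \<subseteq> carrier L" using insert root_set_carrier by auto
    let ?F = "adjoin L E A"
    have F: "subfield ?F L" "K \<subseteq> ?F" "t \<in> ring_hom (L\<lparr>carrier := ?F\<rparr>) L"
      using t(1) unfolding embedding_def by auto
    note alg = algebraic_over_intermediate[OF F(2) xL]
    obtain y where y: "y \<in> R" "eval (map t (Irr ?F x)) y = \<zero>"
      using conjugate_exists[OF t(1)] insert by auto
    obtain u where u: "u \<in> ring_hom (L\<lparr>carrier := simple_extension ?F x\<rparr>) L" "\<And>a. a \<in> ?F \<Longrightarrow> u a = t a"
      using hom_extends_to_simple_extension[OF F(1,3) xL alg _ y(2)] y(1) root_set_carrier by blast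
    have eq: "adjoin L E (insert x A) = simple_extension ?F x"
      using adjoin_insert[OF E(1) AL xL alg] .
    have "subfield (adjoin L E (insert x A)) L"
      using adjoin_subfield[OF E(1), of "insert x A"] xL AL by simp
    moreover have "K \<subseteq> adjoin L E (insert x A)" using subset_trans[OF E(2) adjoin_incl(1)] .
    moreover have "u a = a" if "a \<in> K" for a
      using u(2)[of a] t(1) that F(2) unfolding embedding_def by auto
    ultimately have "embedding (adjoin L E (insert x A)) u"
      unfolding embedding_def using u(1) eq by auto
    moreover have "\<forall>a\<in>E. u a = s a"
      using u(2) t(2) adjoin_incl(1)[of E L A] by (auto simp: subset_iff)
    ultimately show ?case by blast
  qed
  then show ?thesis using that by blast
qed

section \<open>The splitting field and its automorphisms\<close>

lemma adj_subfield: "B \<subseteq> R \<Longrightarrow> subfield (adj B) L"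
  using adjoin_subfield[OF subfield_axioms] root_set_carrier by blast

lemma N_subfield: "subfield N L"
  unfolding splitting_field_def using adj_subfield by blast

lemma N_incl: "K \<subseteq> N" "R \<subseteq> N"
  unfolding splitting_field_def using adjoin_incl by metis+

lemma N_eq_generate: "N = generate_field L (K \<union> R)"
  unfolding splitting_field_def adjoin_def ..

lemma adj_mono:
  assumes "C \<subseteq> R" "B \<subseteq> adj C" shows "adj B \<subseteq> adj C"
  using adjoin_least[OF adj_subfield[OF assms(1)] adjoin_incl(1) assms(2)] .

lemma adj_le_N: "B \<subseteq> R \<Longrightarrow> adj B \<subseteq> N"
  unfolding splitting_field_def by (rule adj_mono[OF subset_refl subset_trans[OF _ adjoin_incl(2)]])

text \<open>The coefficients of \<open>f\<close> are fixed, so roots go to roots; an injective map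
  of a finite set to itself is onto.\<close>

lemma embedding_permutes_root_set:
  assumes s: "embedding N s" shows "bij_betw s R R"
proof -
  have sh: "s \<in> ring_hom (L\<lparr>carrier := N\<rparr>) L" and sK: "\<forall>a\<in>K. s a = a"
    using s unfolding embedding_def by auto
  interpret H: ring_hom_ring "L\<lparr>carrier := N\<rparr>" L s
    using sh subring_is_ring[OF subfieldE(1)[OF N_subfield]] ring_axioms by (intro ring_hom_ringI2)
  have inj: "inj_on s R"
    using non_trivial_field_hom_is_inj[OF sh subfield_iff(2)[OF N_subfield] field_axioms] N_incl(2)
    by (auto intro: inj_on_subset)
  have "s x \<in> R" if x: "x \<in> R" for x
  proof -
    have sf: "set f \<subseteq> N" using f_closed N_incl(1) unfolding univ_poly_def polynomial_def by auto
    have "s (eval f x) = eval (map s f) (s x)"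
      using H.eval_hom'[of x f] x N_incl(2) sf eval_consistent[OF subfieldE(1)[OF N_subfield]] by auto
    then show ?thesis
      using map_fixed_poly[OF sK f_closed] x H.hom_zero H.hom_closed[of x] N_incl(2)
      by (auto simp: mem_root_set_iff)
  qed
  then have "s ` R \<subseteq> R" by blast
  then show ?thesis using inj endo_inj_surj[OF finite_root_set] unfolding bij_betw_def by blast
qed

lemma galois_embedding: "g \<in> G \<Longrightarrow> embedding N g"
  using N_subfield N_incl subfieldE(3)[OF N_subfield]
  unfolding embedding_def galois_group_def by (auto simp: ring_hom_def Pi_iff subset_iff)

text \<open>This is the normality of \<open>N\<close>: the generators \<open>R\<close> are permuted
  and \<open>K\<close> is fixed, so \<open>N\<close> is mapped onto itself. \<open>restrict\<close>
  supplies the extensionality that \<open>Bij\<close> demands.\<close>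

lemma embedding_restrict_galois:
  assumes s: "embedding N s" shows "restrict s N \<in> G"
proof -
  have sh: "s \<in> ring_hom (L\<lparr>carrier := N\<rparr>) L" and sK: "\<forall>a\<in>K. s a = a"
    using s unfolding embedding_def by auto
  have "s ` N = generate_field L (s ` (K \<union> R))"
    using hom_image_generate_field[OF N_subfield sh, of "K \<union> R"] N_incl unfolding N_eq_generate by blast
  also have "s ` (K \<union> R) = K \<union> R"
    using embedding_permutes_root_set[OF s] sK unfolding bij_betw_def by (simp add: image_Un)
  finally have img: "s ` N = N" unfolding N_eq_generate .
  have "inj_on s N"
    using non_trivial_field_hom_is_inj[OF sh subfield_iff(2)[OF N_subfield] field_axioms] by simp
  then have "restrict s N \<in> Bij N" using img unfolding Bij_def by (auto simp: bij_betw_def)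
  moreover have "restrict s N \<in> ring_hom (L\<lparr>carrier := N\<rparr>) (L\<lparr>carrier := N\<rparr>)"
    using ring_hom_memE[OF sh] img subringE[OF subfieldE(1)[OF N_subfield]]
    by (intro ring_hom_memI) auto
  ultimately show ?thesis using sK N_incl(1) unfolding galois_group_def by (auto simp: subset_iff)
qed

lemma galois_permutes: "g \<in> G \<Longrightarrow> bij_betw g R R"
  using embedding_permutes_root_set[OF galois_embedding] .

lemma galois_agree_on_adj:
  assumes "g \<in> G" "h \<in> G" "B \<subseteq> R" "\<And>b. b \<in> B \<Longrightarrow> g b = h b" "a \<in> adj B"
  shows "g a = h a"
proof -
  have sub: "K \<union> B \<subseteq> N" using N_incl assms(3) by blast
  note e = galois_embedding[OF assms(1)] galois_embedding[OF assms(2)]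
  have eq: "\<And>c. c \<in> K \<union> B \<Longrightarrow> g c = h c"
    using e assms(4) unfolding embedding_def by auto
  have "g \<in> ring_hom (L\<lparr>carrier := N\<rparr>) L" "h \<in> ring_hom (L\<lparr>carrier := N\<rparr>) L"
    using e unfolding embedding_def by auto
  from hom_eq_on_generate_field[OF N_subfield this sub eq] show ?thesis
    using assms(5) unfolding adjoin_def by simp
qed

text \<open>Generators determine the values on \<open>N\<close>, and extensionality settles the
  values outside.\<close>

lemma galois_eqI:
  assumes "g \<in> G" "h \<in> G" "B \<subseteq> R" "adj B = N" "\<And>b. b \<in> B \<Longrightarrow> g b = h b"
  shows "g = h"
proof -
  have "g \<in> extensional N" "h \<in> extensional N"
    using assms(1,2) unfolding galois_group_def Bij_def by auto
  then show ?thesis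
    using galois_agree_on_adj[OF assms(1,2,3,5)] assms(4) by (metis extensionalityI)
qed

lemma id_embedding:
  assumes "B \<subseteq> R" shows "embedding (adj B) (\<lambda>a. a)"
  unfolding embedding_def using adj_subfield[OF assms] subsetD[OF subfieldE(3)[OF adj_subfield[OF assms]]] adjoin_incl(1)[of K L B]
  by (auto simp: ring_hom_def)

lemma galois_one: "(\<lambda>a\<in>N. a) \<in> G"
  using embedding_restrict_galois[of "\<lambda>a. a"] id_embedding[OF subset_refl] unfolding splitting_field_def by auto

lemma galois_comp:
  assumes "g \<in> G" "h \<in> G"
  shows "(\<lambda>a\<in>N. h (g a)) \<in> G"
proof -
  have s: "g \<in> ring_hom (L\<lparr>carrier := N\<rparr>) (L\<lparr>carrier := N\<rparr>)"
    and t: "h \<in> ring_hom (L\<lparr>carrier := N\<rparr>) (L\<lparr>carrier := N\<rparr>)"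
    using assms unfolding galois_group_def by auto
  have "(\<lambda>a. h (g a)) \<in> ring_hom (L\<lparr>carrier := N\<rparr>) L"
    using ring_hom_memE[OF s] ring_hom_memE[OF t] subfieldE(3)[OF N_subfield]
    by (intro ring_hom_memI) (auto simp: subset_iff)
  moreover have "\<forall>a\<in>K. h (g a) = a"
    using assms unfolding galois_group_def by auto
  ultimately show ?thesis
    using N_subfield N_incl by (intro embedding_restrict_galois) (auto simp: embedding_def)
qed

lemma galois_inv:
  assumes "g \<in> G"
  obtains h where "h \<in> G" "\<And>x. x \<in> R \<Longrightarrow> h (g x) = x"
proof -
  have b: "bij_betw g N N" and s: "g \<in> ring_hom (L\<lparr>carrier := N\<rparr>) (L\<lparr>carrier := N\<rparr>)"
    and K: "\<forall>a\<in>K. g a = a"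
    using assms unfolding galois_group_def Bij_def by auto
  let ?t = "inv_into N g"
  have l: "?t (g a) = a" if "a \<in> N" for a using bij_betw_inv_into_left[OF b that] .
  have r: "g (?t a) = a" "?t a \<in> N" if "a \<in> N" for a
    using bij_betw_inv_into_right[OF b that] bij_betwE[OF bij_betw_inv_into[OF b]] that by auto
  note m = subringE[OF subfieldE(1)[OF N_subfield]]
  have "?t \<in> ring_hom (L\<lparr>carrier := N\<rparr>) L"
  proof (rule ring_hom_memI)
    fix a c assume "a \<in> carrier (L\<lparr>carrier := N\<rparr>)" "c \<in> carrier (L\<lparr>carrier := N\<rparr>)"
    then have a: "a \<in> N" "c \<in> N" by auto
    have "g (?t a \<otimes> ?t c) = a \<otimes> c" "g (?t a \<oplus> ?t c) = a \<oplus> c"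
      using ring_hom_memE(2,3)[OF s, of "?t a" "?t c"] r[OF a(1)] r[OF a(2)] by auto
    then show "?t (a \<otimes>\<^bsub>L\<lparr>carrier := N\<rparr>\<^esub> c) = ?t a \<otimes> ?t c" "?t (a \<oplus>\<^bsub>L\<lparr>carrier := N\<rparr>\<^esub> c) = ?t a \<oplus> ?t c"
      using l[of "?t a \<otimes> ?t c"] l[of "?t a \<oplus> ?t c"] m(6,7) r(2)[OF a(1)] r(2)[OF a(2)] by auto
  next
    fix a assume "a \<in> carrier (L\<lparr>carrier := N\<rparr>)"
    then show "?t a \<in> carrier L" using r(2) subfieldE(3)[OF N_subfield] by auto
  next
    show "?t \<one>\<^bsub>L\<lparr>carrier := N\<rparr>\<^esub> = \<one>" using l[of \<one>] m(3) ring_hom_memE(4)[OF s] by simp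
  qed
  moreover have "\<forall>a\<in>K. ?t a = a" using l K N_incl(1) by (metis subsetD)
  ultimately have "restrict ?t N \<in> G"
    using N_subfield N_incl by (intro embedding_restrict_galois) (auto simp: embedding_def)
  moreover have "restrict ?t N (g x) = x" if "x \<in> R" for x
    using l[of x] that N_incl(2) bij_betwE[OF galois_permutes[OF assms]] by auto
  ultimately show ?thesis using that by blast
qed

section \<open>Orbits of pointwise stabilisers and relative degrees\<close>

definition orb :: "'a set \<Rightarrow> 'a \<Rightarrow> 'a set" where
  "orb B x = {g x |g. g \<in> G \<and> (\<forall>b\<in>B. g b = b)}"

lemma orb_eq_conjugates:
  assumes B: "B \<subseteq> R" and x: "x \<in> R"
  shows "orb B x = {y. is_root (Irr (adj B) x) y}"
proof -
  note F = adj_subfield[OF B]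
  have KF: "K \<subseteq> adj B" using adjoin_incl(1) .
  have xL: "x \<in> carrier L" using x root_set_carrier by auto
  note alg = algebraic_over_intermediate[OF KF xL]
  let ?p = "Irr (adj B) x"
  note I = IrrE[OF F xL alg]
  have sp: "set ?p \<subseteq> adj B" using I(1) unfolding univ_poly_def polynomial_def by auto
  have pn: "?p \<noteq> []" using pirreducible_degree[OF F I(1,2)] by auto
  show ?thesis
  proof (intro equalityI subsetI)
    fix y assume "y \<in> orb B x"
    then obtain g where g: "g \<in> G" "\<forall>b\<in>B. g b = b" "y = g x" unfolding orb_def by auto
    \<comment> \<open>The coefficients of the minimal polynomial lie in K(B), so they are fixed as
      soon as \<open>B\<close> is.\<close>
    have fixF: "g a = a" if "a \<in> adj B" for a
      using galois_agree_on_adj[OF g(1) galois_one B _ that] g(2) B N_incl(2) adj_le_N[OF B] that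
      by (auto simp: subset_iff)
    have sh: "g \<in> ring_hom (L\<lparr>carrier := N\<rparr>) L"
      using galois_embedding[OF g(1)] unfolding embedding_def by auto
    interpret H: ring_hom_ring "L\<lparr>carrier := N\<rparr>" L g
      using sh subring_is_ring[OF subfieldE(1)[OF N_subfield]] ring_axioms by (intro ring_hom_ringI2)
    have "g (eval ?p x) = eval (map g ?p) (g x)"
      using H.eval_hom'[of x ?p] x N_incl(2) sp adj_le_N[OF B] eval_consistent[OF subfieldE(1)[OF N_subfield]]
      by (auto simp: subset_iff)
    moreover have "map g ?p = ?p" using map_fixed_poly[OF _ I(1)] fixF by blast
    ultimately have "eval ?p y = \<zero>" using g(3) I(4) H.hom_zero by simp
    moreover have "y \<in> carrier L" using g(3) H.hom_closed[of x] x N_incl(2) by auto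
    ultimately show "y \<in> {y. is_root ?p y}" using pn unfolding is_root_def by auto
  next
    fix y assume "y \<in> {y. is_root ?p y}"
    then have y: "y \<in> carrier L" "eval ?p y = \<zero>" unfolding is_root_def by auto
    \<comment> \<open>The inclusion of K(B) into \<open>L\<close> extends to K(B, x) with
      \<open>x\<close> sent to \<open>y\<close>, and then to \<open>N\<close> by adjoining all
      roots.\<close>
    note idh = id_embedding[OF B, unfolded embedding_def]
    obtain t where t: "t \<in> ring_hom (L\<lparr>carrier := simple_extension (adj B) x\<rparr>) L"
        "\<And>a. a \<in> adj B \<Longrightarrow> t a = a" "t x = y"
      using hom_extends_to_simple_extension[OF F _ xL alg y(1), of "\<lambda>a. a"] idh y(2) by auto
    have eq: "adj (insert x B) = simple_extension (adj B) x"
      using adjoin_insert[OF subfield_axioms _ xL alg] B root_set_carrier by blast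
    have xB: "insert x B \<subseteq> R" using x B by auto
    have "embedding (adj (insert x B)) t"
      unfolding embedding_def using t(1,2) adj_subfield[OF xB] adjoin_incl(1)[of K L "insert x B"] KF eq
      by (auto simp: subset_iff)
    then obtain u where u: "embedding (adjoin L (adj (insert x B)) R) u"
        "\<And>a. a \<in> adj (insert x B) \<Longrightarrow> u a = t a"
      using embedding_extends finite_root_set by blast
    have "adjoin L (adj (insert x B)) R = N"
    proof
      show "adjoin L (adj (insert x B)) R \<subseteq> N"
        using adjoin_least[OF N_subfield adj_le_N[OF xB] N_incl(2)] .
      have "subfield (adjoin L (adj (insert x B)) R) L" using u(1) unfolding embedding_def by auto
      then show "N \<subseteq> adjoin L (adj (insert x B)) R"
        unfolding splitting_field_def
        using adjoin_least[OF _ subset_trans[OF adjoin_incl(1)[of K L "insert x B"] adjoin_incl(1)] adjoin_incl(2)]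
        by blast
    qed
    with u(1) have r: "restrict u N \<in> G" using embedding_restrict_galois by simp
    have "u b = b" if "b \<in> B" for b
      using u(2)[of b] t(2)[of b] that adjoin_incl(2)[of B L K] adjoin_incl(2)[of "insert x B" L K]
      by (auto simp: subset_iff)
    moreover have "u x = y" using u(2)[of x] t(3) adjoin_incl(2)[of "insert x B" L K] by auto
    ultimately show "y \<in> orb B x"
      unfolding orb_def using r x B N_incl(2) by (auto intro!: exI[of _ "restrict u N"])
  qed
qed

lemma card_orb:
  assumes B: "B \<subseteq> R" and x: "x \<in> R"
  shows "card (orb B x) = degree (Irr (adj B) x)"
proof -
  have KF: "K \<subseteq> adj B" using adjoin_incl(1) .
  note F = adj_subfield[OF B]
  have xL: "x \<in> carrier L" using x root_set_carrier by auto
  note I = IrrE[OF F xL algebraic_over_intermediate[OF KF xL]]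
  show ?thesis
    using card_roots_of_divisor(1)[OF carrier_polynomial_shell[OF subfieldE(1)[OF F] I(1)] Irr_divides_f[OF F KF x]]
      orb_eq_conjugates[OF B x] by simp
qed

text \<open>The tower law, with the relative degree of K(B, x) over K(B) counted by
  \<open>card_orb\<close>.\<close>

lemma dimension_adj_insert:
  assumes B: "B \<subseteq> R" and x: "x \<in> R" and d: "dimension d K (adj B)"
  shows "dimension (d * card (orb B x)) K (adj (insert x B))"
proof -
  have KF: "K \<subseteq> adj B" using adjoin_incl(1) .
  note F = adj_subfield[OF B]
  have xL: "x \<in> carrier L" using x root_set_carrier by auto
  note alg = algebraic_over_intermediate[OF KF xL]
  have eq: "adj (insert x B) = simple_extension (adj B) x"
    using adjoin_insert[OF subfield_axioms _ xL alg] B root_set_carrier by blast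
  show ?thesis
    using telescopic_base[OF subfield_axioms F d dimension_simple_extension[OF F xL alg]]
    unfolding eq card_orb[OF B x] .
qed

lemma mem_orb_self: "x \<in> R \<Longrightarrow> B \<subseteq> R \<Longrightarrow> x \<in> orb B x"
  unfolding orb_def using galois_one N_incl(2) by (auto simp: subset_iff intro!: exI[of _ "\<lambda>a\<in>N. a"])

text \<open>By separability a one-element orbit means that the minimal polynomial over K(B) is
  linear, so that \<open>x\<close> is minus its constant coefficient.\<close>

lemma mem_adj_iff:
  assumes B: "B \<subseteq> R" and x: "x \<in> R"
  shows "x \<in> adj B \<longleftrightarrow> orb B x = {x}"
proof
  assume xa: "x \<in> adj B"
  have "g x = x" if "g \<in> G" "\<forall>b\<in>B. g b = b" for g
    using galois_agree_on_adj[OF that(1) galois_one B _ xa] that(2) x B N_incl(2) by (auto simp: subset_iff)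
  then show "orb B x = {x}" using mem_orb_self[OF x B] unfolding orb_def by auto
next
  assume o: "orb B x = {x}"
  have KF: "K \<subseteq> adj B" using adjoin_incl(1) .
  note F = adj_subfield[OF B]
  have xL: "x \<in> carrier L" using x root_set_carrier by auto
  note I = IrrE[OF F xL algebraic_over_intermediate[OF KF xL]]
  have "degree (Irr (adj B) x) = 1" using card_orb[OF B x] o by simp
  then obtain a b where ab: "a \<in> adj B" "a \<noteq> \<zero>" "b \<in> adj B" "Irr (adj B) x = [a, b]"
    using degree_oneE[OF I(1)] by auto
  have "a = \<one>" using I(3) ab(4) by simp
  moreover have bL: "b \<in> carrier L" using ab(3) subfieldE(3)[OF F] by auto
  ultimately have "x \<oplus> b = \<zero>" using I(4) ab(4) xL by simp
  then have "x = \<ominus> b" using minus_equality[of x b] xL bL by simp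
  then show "x \<in> adj B" using subringE(5)[OF subfieldE(1)[OF F] ab(3)] by simp
qed

lemma adj_empty: "adj {} = K"
  using adjoin_least[OF subfield_axioms subset_refl, of "{}"] adjoin_incl(1)[of K L "{}"] by auto

end

section \<open>Lists without adjacent repetitions and distinct lists\<close>

lemma falling_factorial_Suc: "falling_factorial n (Suc j) = falling_factorial n j * (n - j)"
  unfolding falling_factorial_def by simp

lemma falling_factorial_pos: "j \<le> n \<Longrightarrow> falling_factorial n j > 0"
  unfolding falling_factorial_def by auto

lemma card_distinct_lists:
  assumes "finite A" "m \<le> card A"
  shows "card {xs. length xs = m \<and> distinct xs \<and> set xs \<subseteq> A} = falling_factorial (card A) m"
proof -
  have "\<Prod>{card A - m + 1..card A} = (\<Prod>i<m. card A - i)"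
    using assms(2) by (intro prod.reindex_bij_witness[of _ "\<lambda>i. card A - i" "\<lambda>i. card A - i"]) auto
  then show ?thesis
    using card_lists_distinct_length_eq[OF assms] unfolding falling_factorial_def by simp
qed

text \<open>Up to index \<open>j\<close> nothing is dropped, so entry \<open>Suc j\<close> of the
  shortened list is the value at the first place where the list leaves \<open>xs ! j\<close>. For a
  tower this is the first field beyond a given one.\<close>

lemma remdups_adj_first_change:
  assumes "j < length xs" "\<And>i. i < j \<Longrightarrow> xs ! i \<noteq> xs ! Suc i" "Suc j < length (remdups_adj xs)"
  shows "\<exists>l. j < l \<and> l < length xs \<and> (\<forall>i. j \<le> i \<and> i < l \<longrightarrow> xs ! i = xs ! j) \<and>
    xs ! l \<noteq> xs ! j \<and> remdups_adj xs ! Suc j = xs ! l"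
  using assms
proof (induction xs arbitrary: j rule: remdups_adj.induct)
  case (3 x y xs)
  show ?case
  proof (cases "x = y")
    case True
    \<comment> \<open>A repetition at the very start contradicts the assumption on adjacent entries
      unless \<open>j\<close> is 0.\<close>
    have j: "j = 0" using 3(4)[of 0] True by (cases j) auto
    have "0 < length (y # xs)" "Suc 0 < length (remdups_adj (y # xs))" using 3(5) True j by simp_all
    then obtain l where l: "0 < l" "l < length (y # xs)" "\<forall>i. 0 \<le> i \<and> i < l \<longrightarrow> (y # xs) ! i = (y # xs) ! 0"
        "(y # xs) ! l \<noteq> (y # xs) ! 0" "remdups_adj (y # xs) ! Suc 0 = (y # xs) ! l"
      using "3.IH"(1)[OF True, of 0] 3(5) True j by auto
    have "(x # y # xs) ! i = x" if "i < Suc l" for i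
      using l(3)[rule_format, of "i - 1"] that True by (cases i) auto
    then have "\<forall>i. j \<le> i \<and> i < Suc l \<longrightarrow> (x # y # xs) ! i = (x # y # xs) ! j" using j by simp
    then show ?thesis using l(1,2,4,5) True j by (intro exI[of _ "Suc l"]) simp
  next
    case False
    show ?thesis
    proof (cases j)
      case 0
      have "remdups_adj (y # xs) ! 0 = y" by (metis hd_conv_nth list.distinct(1) list.sel(1) remdups_adj_Nil_iff hd_remdups_adj)
      then show ?thesis using False 0 by (intro exI[of _ 1]) auto
    next
      case (Suc j')
      have "\<And>i. i < j' \<Longrightarrow> (y # xs) ! i \<noteq> (y # xs) ! Suc i" using 3(4)[of "Suc _"] Suc by auto
      moreover have len: "j' < length (y # xs)" "Suc j' < length (remdups_adj (y # xs))" using 3(3,5) False Suc by auto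
      ultimately obtain l where l: "j' < l" "l < length (y # xs)" "\<forall>i. j' \<le> i \<and> i < l \<longrightarrow> (y # xs) ! i = (y # xs) ! j'"
          "(y # xs) ! l \<noteq> (y # xs) ! j'" "remdups_adj (y # xs) ! Suc j' = (y # xs) ! l"
        using "3.IH"(2)[OF False, of j'] len by blast
      have "(x # y # xs) ! i = (x # y # xs) ! j" if "j \<le> i" "i < Suc l" for i
        using l(3)[rule_format, of "i - 1"] that Suc by (cases i) auto
      then have "\<forall>i. j \<le> i \<and> i < Suc l \<longrightarrow> (x # y # xs) ! i = (x # y # xs) ! j" by blast
      then show ?thesis using l(1,2,4,5) False Suc by (intro exI[of _ "Suc l"]) simp
    qed
  qed
qed auto

text \<open>The changes before index \<open>j\<close> already use up all \<open>Suc j\<close>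
  entries of the shortened list, so no change can follow.\<close>

lemma remdups_adj_eventually_const:
  assumes "j < length xs" "\<And>i. i < j \<Longrightarrow> xs ! i \<noteq> xs ! Suc i" "length (remdups_adj xs) = Suc j"
    "j \<le> i" "i < length xs"
  shows "xs ! i = xs ! j"
  using assms
proof (induction xs arbitrary: i j rule: remdups_adj.induct)
  case (3 x y xs)
  show ?case
  proof (cases "x = y")
    case True
    have j: "j = 0" using 3(4)[of 0] True by (cases j) auto
    then show ?thesis using "3.IH"(1)[OF True, of 0 "i - 1"] 3(5,7) True by (cases i) auto
  next
    case False
    then obtain j' where j: "j = Suc j'" using 3(5) by (cases j) auto
    have "\<And>i. i < j' \<Longrightarrow> (y # xs) ! i \<noteq> (y # xs) ! Suc i" using 3(4)[of "Suc _"] j by auto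
    then show ?thesis using "3.IH"(2)[OF False, of j' "i - 1"] 3(3,5,6,7) False j by (cases i) auto
  qed
qed auto

lemma remdups_adj_eq_take:
  assumes "k < length xs" "\<And>i. i < k \<Longrightarrow> xs ! i \<noteq> xs ! Suc i"
    "\<And>i. k \<le> i \<Longrightarrow> i < length xs \<Longrightarrow> xs ! i = xs ! k"
  shows "remdups_adj xs = take (Suc k) xs"
  using assms
proof (induction xs arbitrary: k rule: remdups_adj.induct)
  case (3 x y xs)
  show ?case
  proof (cases "x = y")
    case True
    have k: "k = 0" using 3(4)[of 0] True by (cases k) auto
    have "(y # xs) ! i = (y # xs) ! 0" if "i < length (y # xs)" for i
      using 3(5)[of "Suc i"] k True that by simp
    then have "remdups_adj (y # xs) = take (Suc 0) (y # xs)"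
      using "3.IH"(1)[OF True, of 0] unfolding True by simp
    then show ?thesis using True k by simp
  next
    case False
    then obtain k' where k: "k = Suc k'" using 3(5)[of 1] by (cases k) auto
    have "\<And>i. i < k' \<Longrightarrow> (y # xs) ! i \<noteq> (y # xs) ! Suc i" using 3(4)[of "Suc _"] k by auto
    moreover have "(y # xs) ! i = (y # xs) ! k'" if "k' \<le> i" "i < length (y # xs)" for i
      using 3(5)[of "Suc i"] k that by simp
    moreover have "k' < length (y # xs)" using 3(3) k by simp
    ultimately have "remdups_adj (y # xs) = take (Suc k') (y # xs)"
      using "3.IH"(2)[OF False, of k'] by blast
    then show ?thesis using False k by simp
  qed
next
  case 1
  show ?case using 1(1) by simp
next
  case (2 x)
  show ?case using 2(1) by simp
qed

text \<open>Distinctness makes entry i the only element by which the prefix of length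
  \<open>Suc i\<close> exceeds that of length i. This recovers a list of roots from the fields of
  its prefixes.\<close>

lemma eq_if_prefix_sets_eq:
  assumes "length xs = length ys" "distinct xs" "distinct ys"
    "\<And>i. i \<le> length xs \<Longrightarrow> set (take i xs) = set (take i ys)"
  shows "xs = ys"
proof (rule nth_equalityI[OF assms(1)])
  fix i assume i: "i < length xs"
  have *: "set (take (Suc i) zs) - set (take i zs) = {zs ! i}" if "distinct zs" "i < length zs" for zs :: "'a list"
    using distinct_take[OF that(1), of "Suc i"] that(2) by (auto simp: take_Suc_conv_app_nth)
  show "xs ! i = ys ! i" using *[of xs] *[of ys] assms i by (metis Suc_leI less_imp_le singleton_inject)
qed

section \<open>Transitivity on tuples of roots\<close>

context separable_splitting
begin

text \<open>An injective map that fixes \<open>B\<close> pointwise cannot move an outside root into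
  \<open>B\<close>.\<close>

lemma orb_subset:
  assumes "B \<subseteq> R" "x \<in> R - B" shows "orb B x \<subseteq> R - B"
proof
  fix y assume "y \<in> orb B x"
  then obtain g where g: "g \<in> G" "\<forall>b\<in>B. g b = b" "y = g x" unfolding orb_def by auto
  note bij = galois_permutes[OF g(1)]
  have "y \<in> R" using bij_betwE[OF bij] g(3) assms(2) by auto
  moreover have "y \<notin> B"
    using g assms bij_betw_imp_inj_on[OF bij] by (metis DiffD1 DiffD2 inj_onD subsetD)
  ultimately show "y \<in> R - B" by simp
qed

text \<open>If y = g x and z = h x, then the inverse of g followed by h sends y to z and still fixes
  \<open>B\<close>.\<close>

lemma orb_swap:
  assumes B: "B \<subseteq> R" and x: "x \<in> R" and y: "y \<in> orb B x" shows "orb B x \<subseteq> orb B y"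
proof
  fix z assume "z \<in> orb B x"
  then obtain h where h: "h \<in> G" "\<forall>b\<in>B. h b = b" "z = h x" unfolding orb_def by auto
  obtain g where g: "g \<in> G" "\<forall>b\<in>B. g b = b" "y = g x" using y unfolding orb_def by auto
  obtain i where i: "i \<in> G" "\<And>x. x \<in> R \<Longrightarrow> i (g x) = x" using galois_inv[OF g(1)] by blast
  have ib: "i b = b" if "b \<in> B" for b using i(2)[of b] g(2) that B by auto
  have yN: "y \<in> N" using bij_betwE[OF galois_permutes[OF g(1)]] x g(3) N_incl(2) by auto
  have "(\<lambda>a\<in>N. h (i a)) \<in> G" using galois_comp[OF i(1) h(1)] .
  moreover have "\<forall>b\<in>B. (\<lambda>a\<in>N. h (i a)) b = b" using h(2) ib B N_incl(2) by (auto simp: subset_iff)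
  moreover have "z = (\<lambda>a\<in>N. h (i a)) y" using yN h(3) g(3) i(2)[OF x] by simp
  ultimately show "z \<in> orb B y" unfolding orb_def by blast
qed

definition fixer_transitive :: "nat \<Rightarrow> bool" where
  "fixer_transitive j \<longleftrightarrow> (\<forall>B x. B \<subseteq> R \<and> card B = j \<and> x \<in> R - B \<longrightarrow> orb B x = R - B)"

lemma fixer_transitiveD:
  "fixer_transitive j \<Longrightarrow> B \<subseteq> R \<Longrightarrow> card B = j \<Longrightarrow> x \<in> R - B \<Longrightarrow> orb B x = R - B"
  unfolding fixer_transitive_def by blast

text \<open>One orbit that fills \<open>R - B\<close> contains \<open>x\<close>, and then the orbit
  of \<open>x\<close> is as large.\<close>

lemma orb_eq_if_large_orb:
  assumes B: "B \<subseteq> R" and y: "y \<in> R - B" "card (orb B y) = card (R - B)" and x: "x \<in> R - B"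
  shows "orb B x = R - B"
proof -
  have "orb B y = R - B"
    using card_subset_eq[OF _ orb_subset[OF B y(1)] y(2)] finite_root_set by simp
  then show ?thesis using orb_swap[OF B, of y x] orb_subset[OF B x] x y(1) by auto
qed

definition tuple_transitive :: "nat \<Rightarrow> bool" where
  "tuple_transitive j \<longleftrightarrow> (\<forall>as bs. length as = j \<and> distinct as \<and> set as \<subseteq> R \<and>
     length bs = j \<and> distinct bs \<and> set bs \<subseteq> R \<longrightarrow> (\<exists>g\<in>G. map g as = bs))"

lemma tuple_transitiveD:
  "tuple_transitive j \<Longrightarrow> length as = j \<Longrightarrow> distinct as \<Longrightarrow> set as \<subseteq> R \<Longrightarrow>
    length bs = j \<Longrightarrow> distinct bs \<Longrightarrow> set bs \<subseteq> R \<Longrightarrow> \<exists>g\<in>G. map g as = bs"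
  unfolding tuple_transitive_def by blast

text \<open>Move the first \<open>j\<close> entries into place, then correct the image of the last
  one by an automorphism fixing the entries already placed.\<close>

lemma tuple_transitive_Suc:
  assumes t: "tuple_transitive j" and q: "fixer_transitive j"
  shows "tuple_transitive (Suc j)"
  unfolding tuple_transitive_def
proof (intro allI impI, elim conjE)
  fix as bs :: "'a list"
  assume as: "length as = Suc j" "distinct as" "set as \<subseteq> R" and bs: "length bs = Suc j" "distinct bs" "set bs \<subseteq> R"
  obtain as' a where a: "as = as' @ [a]" using as(1) by (cases as rule: rev_cases) auto
  obtain bs' b where b: "bs = bs' @ [b]" using bs(1) by (cases bs rule: rev_cases) auto
  obtain g where g: "g \<in> G" "map g as' = bs'" using tuple_transitiveD[OF t, of as' bs'] as bs a b by auto
  note bij = galois_permutes[OF g(1)]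
  have "g a \<in> R" using bij_betwE[OF bij] as a by auto
  moreover have "g a \<notin> set bs'"
  proof
    assume "g a \<in> set bs'"
    then obtain c where "c \<in> set as'" "g a = g c" using g(2) by auto
    then show False using bij_betw_imp_inj_on[OF bij] as a by (auto dest!: inj_onD)
  qed
  moreover have "b \<in> R - set bs'" "set bs' \<subseteq> R" "card (set bs') = j" using bs b by (auto simp: distinct_card)
  ultimately have "b \<in> orb (set bs') (g a)" using fixer_transitiveD[OF q, of "set bs'" "g a"] by auto
  then obtain h where h: "h \<in> G" "\<forall>c\<in>set bs'. h c = c" "b = h (g a)" unfolding orb_def by auto
  have "map (\<lambda>a\<in>N. h (g a)) as = bs"
    using h(2,3) g(2) as(3) N_incl(2) unfolding a b by (auto simp: subset_iff)
  then show "\<exists>g\<in>G. map g as = bs" using galois_comp[OF g(1) h(1)] by blast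
qed

lemma extend_distinct_list:
  assumes "distinct as" "set as \<subseteq> R" "length as < card R"
  obtains a where "a \<in> R" "a \<notin> set as"
proof -
  have "card (set as) < card R" using assms by (simp add: distinct_card)
  then have "set as \<noteq> R" by auto
  then show ?thesis using assms(2) that by blast
qed

lemma tuple_transitive_pred:
  assumes t: "tuple_transitive (Suc j)" and j: "j < card R"
  shows "tuple_transitive j"
  unfolding tuple_transitive_def
proof (intro allI impI, elim conjE)
  fix as bs :: "'a list"
  assume as: "length as = j" "distinct as" "set as \<subseteq> R" and bs: "length bs = j" "distinct bs" "set bs \<subseteq> R"
  obtain a where "a \<in> R" "a \<notin> set as" using extend_distinct_list as j by metis
  moreover obtain b where "b \<in> R" "b \<notin> set bs" using extend_distinct_list bs j by metis
  ultimately show "\<exists>g\<in>G. map g as = bs"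
    using tuple_transitiveD[OF t, of "as @ [a]" "bs @ [b]"] as bs by auto
qed

text \<open>Enumerate \<open>B\<close> and append \<open>x\<close> to one copy, \<open>y\<close> to
  the other; an automorphism matching the two tuples fixes \<open>B\<close> and sends
  \<open>x\<close> to \<open>y\<close>.\<close>

lemma tuple_transitive_imp_fixer_transitive:
  assumes t: "tuple_transitive (Suc j)" shows "fixer_transitive j"
  unfolding fixer_transitive_def
proof (intro allI impI, elim conjE)
  fix B x assume B: "B \<subseteq> R" "card B = j" and x: "x \<in> R - B"
  obtain as where as: "set as = B" "distinct as"
    using finite_distinct_list[OF finite_subset[OF B(1) finite_root_set]] by auto
  then have len: "length as = j" using B(2) distinct_card by fastforce
  have "y \<in> orb B x" if y: "y \<in> R - B" for y
  proof -
    obtain g where g: "g \<in> G" "map g (as @ [x]) = as @ [y]"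
      using tuple_transitiveD[OF t, of "as @ [x]" "as @ [y]"] as len B(1) x y by auto
    then have "map g as = map id as" "g x = y" by simp_all
    then have "\<forall>b\<in>B. g b = b" using as(1) unfolding map_eq_conv by simp
    then show ?thesis using g(1) \<open>g x = y\<close> unfolding orb_def by blast
  qed
  then show "orb B x = R - B" using orb_subset[OF B(1) x] by blast
qed

lemma tuple_transitive_iff:
  assumes "k \<le> card R" shows "tuple_transitive k \<longleftrightarrow> (\<forall>j<k. fixer_transitive j)"
  using assms
proof (induction k)
  case 0
  then show ?case using galois_one unfolding tuple_transitive_def by auto
next
  case (Suc k)
  then show ?case
    using tuple_transitive_Suc[of k] tuple_transitive_pred[of k] tuple_transitive_imp_fixer_transitive[of k]
    by (auto simp: less_Suc_eq)
qed

text \<open>The middle term of the whole argument: sharp transitivity and the degree condition on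
  cluster towers are both compared with it. The name reflects that towers then grow for exactly k
  steps (for 0 < k < n).\<close>

definition strict_towers :: "nat \<Rightarrow> bool" where
  "strict_towers k \<longleftrightarrow> (\<forall>j<k. fixer_transitive j) \<and> (\<forall>B. B \<subseteq> R \<and> card B = k \<longrightarrow> adj B = N)"

lemma generates_iff:
  assumes "B \<subseteq> R" shows "adj B = N \<longleftrightarrow> R \<subseteq> adj B"
proof
  show "adj B = N \<Longrightarrow> R \<subseteq> adj B" using N_incl(2) by simp
  assume "R \<subseteq> adj B"
  then have "N \<subseteq> adj B" unfolding splitting_field_def using adj_mono[OF assms] by blast
  then show "adj B = N" using adj_le_N[OF assms] by blast
qed

text \<open>Existence is transitivity on tuples. Uniqueness says that only the identity fixes k
  given roots, which means that these roots generate \<open>N\<close>.\<close>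

lemma sharply_transitive_iff:
  assumes k: "k \<le> card R"
  shows "sharply_transitive_on k (galois_group L K N) R \<longleftrightarrow> strict_towers k"
proof
  assume sh: "sharply_transitive_on k (galois_group L K N) R"
  have uniq: "\<exists>!g. g \<in> G \<and> (\<forall>i<k. g (as ! i) = bs ! i)"
    if "length as = k" "distinct as" "set as \<subseteq> R" "length bs = k" "distinct bs" "set bs \<subseteq> R" for as bs
    using sh that unfolding sharply_transitive_on_def by blast
  have "tuple_transitive k"
    unfolding tuple_transitive_def
  proof (intro allI impI, elim conjE)
    fix as bs :: "'a list"
    assume as: "length as = k" "distinct as" "set as \<subseteq> R" and bs: "length bs = k" "distinct bs" "set bs \<subseteq> R"
    then obtain g where "g \<in> G" "\<forall>i<k. g (as ! i) = bs ! i" using uniq[OF as bs] by blast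
    then show "\<exists>g\<in>G. map g as = bs" using as(1) bs(1) by (intro bexI[of _ g]) (auto intro: nth_equalityI)
  qed
  moreover have "adj B = N" if B: "B \<subseteq> R" "card B = k" for B
  proof (rule ccontr)
    assume "adj B \<noteq> N"
    then obtain x where x: "x \<in> R" "x \<notin> adj B" using generates_iff[OF B(1)] by blast
    then have "orb B x \<noteq> {x}" using mem_adj_iff[OF B(1)] by blast
    then obtain g where g: "g \<in> G" "\<forall>b\<in>B. g b = b" "g x \<noteq> x"
      using mem_orb_self[OF x(1) B(1)] unfolding orb_def by auto
    obtain as where as: "set as = B" "distinct as"
      using finite_distinct_list[OF finite_subset[OF B(1) finite_root_set]] by auto
    then have len: "length as = k" using B(2) distinct_card by fastforce
    \<comment> \<open>\<open>g\<close> and the identity both send the enumeration of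
      \<open>B\<close> to itself, against uniqueness.\<close>
    let ?i = "\<lambda>a\<in>N. a"
    have "\<forall>i<k. g (as ! i) = as ! i" using g(2) as(1) len by auto
    moreover have "\<forall>i<k. ?i (as ! i) = as ! i" using as(1) len B(1) N_incl(2) nth_mem[of _ as] by (auto simp: subset_iff)
    ultimately have "g = ?i" using uniq[OF len as(2) _ len as(2)] as(1) B(1) g(1) galois_one by blast
    then show False using g(3) x(1) N_incl(2) by auto
  qed
  ultimately show "strict_towers k" unfolding strict_towers_def using tuple_transitive_iff[OF k] by blast
next
  assume st: "strict_towers k"
  then have tt: "tuple_transitive k" unfolding strict_towers_def using tuple_transitive_iff[OF k] by blast
  show "sharply_transitive_on k (galois_group L K N) R"
    unfolding sharply_transitive_on_def
  proof (intro allI impI, elim conjE)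
    fix as bs :: "'a list"
    assume as: "length as = k" "distinct as" "set as \<subseteq> R" and bs: "length bs = k" "distinct bs" "set bs \<subseteq> R"
    obtain g where g: "g \<in> G" "map g as = bs" using tuple_transitiveD[OF tt as bs] by blast
    show "\<exists>!g. g \<in> G \<and> (\<forall>i<k. g (as ! i) = bs ! i)"
    proof (rule ex1I[of _ g])
      show "g \<in> G \<and> (\<forall>i<k. g (as ! i) = bs ! i)" using g as(1) by (auto simp: nth_map[symmetric])
      fix h assume h: "h \<in> G \<and> (\<forall>i<k. h (as ! i) = bs ! i)"
      have "adj (set as) = N" using st as unfolding strict_towers_def by (auto simp: distinct_card)
      moreover have "h b = g b" if "b \<in> set as" for b
        using that h g(2) as(1) by (auto simp: in_set_conv_nth)
      ultimately show "h = g" using galois_eqI[of h g "set as"] h g(1) as(3) by blast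
    qed
  qed
qed

text \<open>A further root \<open>x\<close> in K(B) would have the orbit \<open>{x}\<close>, but its
  orbit is \<open>R - B\<close>. The bound on \<open>j\<close> says that \<open>R - B\<close> has at
  least two elements.\<close>

lemma adj_Int_roots:
  assumes q: "fixer_transitive j" and j: "Suc j < card R" and B: "B \<subseteq> R" "card B = j"
  shows "adj B \<inter> R = B"
proof -
  have "x \<notin> adj B" if x: "x \<in> R - B" for x
  proof
    assume "x \<in> adj B"
    then have "R - B = {x}" using mem_adj_iff[OF B(1)] fixer_transitiveD[OF q B x] x by simp
    moreover have "card (R - B) = card R - j"
      using card_Diff_subset[OF finite_subset[OF B(1) finite_root_set] B(1)] B(2) by simp
    ultimately show False using j by simp
  qed
  then show ?thesis using B(1) adjoin_incl(2)[of B L K] by blast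
qed

text \<open>The tower law multiplies the orbit sizes n, n - 1, ..., n - j + 1.\<close>

lemma dimension_adj:
  assumes "\<forall>i<j. fixer_transitive i" "B \<subseteq> R" "card B = j"
  shows "dimension (falling_factorial (card R) j) K (adj B)"
  using assms
proof (induction j arbitrary: B)
  case 0
  then have "B = {}" using finite_subset[OF _ finite_root_set] by auto
  then show ?case using dimension_one[OF subfield_axioms] adj_empty by (simp add: falling_factorial_def)
next
  case (Suc j)
  then obtain x C where B: "B = insert x C" "x \<notin> C" "card C = j" by (metis card_Suc_eq)
  have C: "C \<subseteq> R" "x \<in> R - C" using B Suc by auto
  have d: "dimension (falling_factorial (card R) j) K (adj C)" using Suc.IH[OF _ C(1) B(3)] Suc.prems(1) by simp
  have "orb C x = R - C" using fixer_transitiveD[OF _ C(1) B(3) C(2)] Suc.prems(1) by simp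
  then have "card (orb C x) = card R - j"
    using card_Diff_subset[OF finite_subset[OF C(1) finite_root_set] C(1)] B(3) by simp
  then show ?case using dimension_adj_insert[OF C(1) _ d, of x] C(2) B(1) by (simp add: falling_factorial_Suc)
qed

lemma minimal_generating_sets:
  assumes st: "strict_towers k" and k: "k < card R"
  shows "minimal_generating_set L K f B \<longleftrightarrow> B \<subseteq> R \<and> card B = k"
proof -
  have full: "adj B = N" if "B \<subseteq> R" "card B = k" for B using st that unfolding strict_towers_def by blast
  \<comment> \<open>Fewer than k < n roots leave at least two others, so K(B) contains no root
    outside \<open>B\<close>, whereas \<open>N\<close> contains all of \<open>R\<close>.\<close>
  have less: "adj B \<noteq> N" if B: "B \<subseteq> R" "card B < k" for B
  proof
    assume "adj B = N"
    then have "B = R"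
      using adj_Int_roots[OF _ _ B(1) refl] st B(2) k N_incl(2) unfolding strict_towers_def by auto
    then show False using B(2) k by simp
  qed
  have "card B = k" if m: "minimal_generating_set L K f B"
  proof (rule linorder_cases[of "card B" k])
    assume "card B < k"
    then show ?thesis using less m unfolding minimal_generating_set_def by blast
  next
    assume gt: "card B > k"
    \<comment> \<open>A k-element subset already generates \<open>N\<close>, so a larger set is not
      minimal.\<close>
    then obtain A where "A \<subseteq> B" "card A = k" by (metis less_imp_le obtain_subset_with_card_n)
    with gt have "A \<subset> B" by auto
    moreover from this have "adj A = N" using full[of A] \<open>card A = k\<close> m unfolding minimal_generating_set_def by blast
    ultimately show ?thesis using m unfolding minimal_generating_set_def by blast
  qed
  moreover have "minimal_generating_set L K f B" if B: "B \<subseteq> R" "card B = k"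
    using full[OF B] less psubset_card_mono[OF finite_subset[OF B(1) finite_root_set]] B
    unfolding minimal_generating_set_def by blast
  moreover have "B \<subseteq> R" if "minimal_generating_set L K f B"
    using that unfolding minimal_generating_set_def by blast
  ultimately show ?thesis by blast
qed

subsection \<open>Cluster towers\<close>

lemma root_clusters_eq: "root_clusters L K f = (\<lambda>x. {y \<in> R. adj {y} = adj {x}}) ` R"
  unfolding root_clusters_def quotient_def by auto

lemma cluster_ordering_iff:
  "cluster_ordering L K f bs \<longleftrightarrow>
     distinct bs \<and> set bs \<subseteq> R \<and> (\<forall>x\<in>R. \<exists>!b. b \<in> set bs \<and> adj {b} = adj {x})"
proof (cases "set bs \<subseteq> R")
  case True
  then have "b \<in> set bs \<inter> {y \<in> R. adj {y} = adj {x}} \<longleftrightarrow> b \<in> set bs \<and> adj {b} = adj {x}" for b x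
    by auto
  then show ?thesis unfolding cluster_ordering_def root_clusters_eq by simp
next
  case False
  then show ?thesis unfolding cluster_ordering_def by simp
qed

text \<open>Append one chosen representative of each cluster that \<open>as\<close> misses, a
  cluster being identified by the field K(x) that its members share. Starting from the empty list,
  this also shows that cluster towers exist.\<close>

lemma cluster_ordering_exists:
  assumes as: "distinct as" "set as \<subseteq> R"
    and inequiv: "\<And>a b. a \<in> set as \<Longrightarrow> b \<in> set as \<Longrightarrow> adj {a} = adj {b} \<Longrightarrow> a = b"
  obtains cs where "cluster_ordering L K f (as @ cs)"
proof -
  define rep where "rep F = (SOME y. y \<in> R \<and> adj {y} = F)" for F
  have rep: "rep (adj {x}) \<in> R" "adj {rep (adj {x})} = adj {x}" if "x \<in> R" for x
    using someI_ex[of "\<lambda>y. y \<in> R \<and> adj {y} = adj {x}"] that unfolding rep_def by blast+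
  define C where "C = rep ` ((\<lambda>x. adj {x}) ` R - (\<lambda>a. adj {a}) ` set as)"
  have "finite C" unfolding C_def using finite_root_set by simp
  then obtain cs where cs: "set cs = C" "distinct cs" using finite_distinct_list by blast
  have CR: "C \<subseteq> R" unfolding C_def using rep(1) by blast
  have new: "adj {c} \<noteq> adj {a}" if "c \<in> C" "a \<in> set as" for a c
    using that rep(2) unfolding C_def by auto
  have "cluster_ordering L K f (as @ cs)"
    unfolding cluster_ordering_iff
  proof (intro conjI ballI)
    show "distinct (as @ cs)" using as(1) cs new by auto
    show "set (as @ cs) \<subseteq> R" using as(2) cs(1) CR by auto
    fix x assume x: "x \<in> R"
    show "\<exists>!b. b \<in> set (as @ cs) \<and> adj {b} = adj {x}"
    proof (cases "\<exists>a\<in>set as. adj {a} = adj {x}")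
      case True
      then obtain a where a: "a \<in> set as" "adj {a} = adj {x}" by blast
      have "b = a" if "b \<in> set (as @ cs)" "adj {b} = adj {x}" for b
        using that inequiv[of b a] new[of b a] a cs(1) by auto
      then show ?thesis using a by (intro ex1I[of _ a]) auto
    next
      case False
      then have "rep (adj {x}) \<in> C" unfolding C_def using x by blast
      moreover have "c = rep (adj {x})" if "c \<in> C" "adj {c} = adj {x}" for c
        using that rep(2) unfolding C_def by auto
      ultimately show ?thesis using rep(2)[OF x] cs(1) False unfolding set_append by blast
    qed
  qed
  then show ?thesis using that by blast
qed

lemma cluster_ordering_generates:
  assumes "cluster_ordering L K f bs" shows "adj (set bs) = N"
proof -
  have bs: "set bs \<subseteq> R" using assms unfolding cluster_ordering_iff by blast
  have "x \<in> adj (set bs)" if x: "x \<in> R" for x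
  proof -
    obtain b where b: "b \<in> set bs" "adj {b} = adj {x}" using assms x unfolding cluster_ordering_iff by blast
    have "x \<in> adj {b}" using adjoin_incl(2)[of "{x}" L K] b(2) by simp
    also have "adj {b} \<subseteq> adj (set bs)" using adj_mono[OF bs, of "{b}"] adjoin_incl(2)[of "set bs" L K] b(1) by blast
    finally show ?thesis .
  qed
  then show ?thesis using generates_iff[OF bs] by blast
qed

lemma length_tower_of: "length (tower_of L K bs) = Suc (length bs)"
  unfolding tower_of_def by (simp del: upt_Suc)

text \<open>Index 0 is covered as well, since \<open>K\<close> is \<open>adj {}\<close>; thus entry
  i is always generated by the first i roots.\<close>

lemma tower_of_nth:
  assumes "i \<le> length bs" shows "tower_of L K bs ! i = adj (set (take i bs))"
  using assms unfolding tower_of_def by (cases i) (auto simp: adj_empty simp del: upt_Suc)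

lemma tower_of_nth_Suc:
  assumes "i < length bs" shows "tower_of L K bs ! Suc i = adj (insert (bs ! i) (set (take i bs)))"
  using assms tower_of_nth[of "Suc i" bs] by (simp add: take_Suc_conv_app_nth)

lemma adj_prefix_mono:
  assumes "set bs \<subseteq> R" "i \<le> j" shows "adj (set (take i bs)) \<subseteq> adj (set (take j bs))"
proof (rule adj_mono)
  show "set (take j bs) \<subseteq> R" using assms(1) set_take_subset[of j bs] by blast
  show "set (take i bs) \<subseteq> adj (set (take j bs))"
    using set_take_subset_set_take[OF assms(2), of bs] adjoin_incl(2)[of "set (take j bs)" L K] by blast
qed

text \<open>Two different elements force j \<ge> 2, so that \<open>fixer_transitive 1\<close> is
  available and there are more than two roots; then K(a) contains no root but
  \<open>a\<close>.\<close>

lemma roots_inequivalent: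
  assumes q: "\<forall>i<j. fixer_transitive i" and j: "j < card R" and B: "B \<subseteq> R" "card B = j"
    and ab: "a \<in> B" "b \<in> B" "adj {a} = adj {b}"
  shows "a = b"
proof (rule ccontr)
  assume ne: "a \<noteq> b"
  have "card {a, b} \<le> card B" using ab finite_subset[OF B(1) finite_root_set] by (intro card_mono) auto
  then have "2 \<le> j" using ne B(2) by simp
  then have "adj {a} \<inter> R = {a}" using adj_Int_roots[of 1 "{a}"] q j ab(1) B(1) by auto
  moreover have "b \<in> adj {a} \<inter> R" using ab(2,3) adjoin_incl(2)[of "{b}" L K] B(1) by auto
  ultimately show False using ne by simp
qed

text \<open>Root i of the ordering is not in the field of its predecessors by
  \<open>adj_Int_roots\<close>, whose bound holds because i < j < n.\<close>

lemma tower_strict_start: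
  assumes q: "\<forall>i<j. fixer_transitive i" and j: "j < card R"
    and bs: "distinct bs" "set bs \<subseteq> R" "j \<le> length bs" and i: "i < j"
  shows "tower_of L K bs ! i \<noteq> tower_of L K bs ! Suc i"
proof -
  have tk: "set (take i bs) \<subseteq> R" using bs(2) set_take_subset[of i bs] by blast
  have c: "card (set (take i bs)) = i" using bs i by (simp add: distinct_card)
  have b: "bs ! i \<in> R" "bs ! i \<notin> set (take i bs)" "bs ! i \<in> set (take (Suc i) bs)"
    using bs i distinct_take[OF bs(1), of "Suc i"] by (auto simp: take_Suc_conv_app_nth)
  have "bs ! i \<notin> adj (set (take i bs))" using adj_Int_roots[OF _ _ tk c] q i j b by auto
  moreover have "bs ! i \<in> adj (set (take (Suc i) bs))" using b(3) adjoin_incl(2) by (rule subsetD[rotated])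
  ultimately show ?thesis using i bs(3) by (auto simp: tower_of_nth)
qed

text \<open>Lets a prefix of an ordering be exchanged for any other set of roots that generates the
  same field.\<close>

lemma adj_insert_cong:
  assumes "B \<subseteq> R" "C \<subseteq> R" "x \<in> R" "adj B = adj C"
  shows "adj (insert x B) = adj (insert x C)"
proof -
  have "adj (insert x B) \<subseteq> adj (insert x C)" if "B \<subseteq> R" "C \<subseteq> R" "adj B = adj C" for B C
  proof (rule adj_mono)
    show xC: "insert x C \<subseteq> R" using assms(3) that by simp
    have "adj C \<subseteq> adj (insert x C)"
      using adj_mono[OF xC, of C] adjoin_incl(2)[of "insert x C" L K] by blast
    then show "insert x B \<subseteq> adj (insert x C)"
      using adjoin_incl(2)[of "insert x C" L K] adjoin_incl(2)[of B L K] that(3) by blast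
  qed
  then show ?thesis using assms by blast
qed

text \<open>
  Choose a cluster ordering that lists \<open>B\<close> first. The first field of its tower beyond \<open>K(B)\<close> is
  \<open>K(B, y)\<close> for one root \<open>y\<close>, and its prescribed degree says that \<open>y\<close> has \<open>n - j\<close> conjugates
  over \<open>K(B)\<close>.
\<close>

lemma degrees_imp_strict_towers:
  assumes deg: "\<forall>T\<in>cluster_towers L K f. tower_degrees L K T = map (falling_factorial (card R)) [1..<Suc k]"
    and k: "k < card R"
  shows "strict_towers k"
proof -
  have len: "length (remdups_adj (tower_of L K bs)) = Suc k"
    and nth: "j < k \<Longrightarrow> ring.dim L K (remdups_adj (tower_of L K bs) ! Suc j) = falling_factorial (card R) (Suc j)"
    if "cluster_ordering L K f bs" for bs j
  proof -
    have d: "map (\<lambda>E. ring.dim L K E) (tl (remdups_adj (tower_of L K bs))) = map (falling_factorial (card R)) [1..<Suc k]"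
      using deg that unfolding cluster_towers_def tower_degrees_def by auto
    have "length (tl (remdups_adj (tower_of L K bs))) = k" using arg_cong[OF d, of length] by simp
    moreover have "remdups_adj (tower_of L K bs) \<noteq> []" unfolding tower_of_def by simp
    ultimately show l: "length (remdups_adj (tower_of L K bs)) = Suc k"
      by (cases "remdups_adj (tower_of L K bs)") simp_all
    assume "j < k"
    then show "ring.dim L K (remdups_adj (tower_of L K bs) ! Suc j) = falling_factorial (card R) (Suc j)"
      using arg_cong[OF d, of "\<lambda>xs. xs ! j"] l by (simp add: nth_tl del: upt_Suc)
  qed
  \<comment> \<open>Any \<open>j\<close> roots can be put at the head of a cluster ordering, being
    inequivalent by the transitivity of smaller stabilisers.\<close>
  have start: "\<exists>cs. set as = B \<and> length as = j \<and> cluster_ordering L K f (as @ cs)"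
    if "\<forall>i<j. fixer_transitive i" "j \<le> k" "B \<subseteq> R" "card B = j" "set as = B" "distinct as" for j B as
    using cluster_ordering_exists[of as] roots_inequivalent[OF that(1) _ that(3,4)] that k distinct_card[of as]
    by (metis le_less_trans)
  \<comment> \<open>Strong induction: the smaller cases put \<open>B\<close> at the head of an
    ordering, keep its tower strict up to index \<open>j\<close> and give the degree of
    K(B).\<close>
  have q: "fixer_transitive j" if "j < k" for j
    using that
  proof (induction j rule: less_induct)
    case (less j)
    then have IH: "\<forall>i<j. fixer_transitive i" by simp
    show ?case
      unfolding fixer_transitive_def
    proof (intro allI impI, elim conjE)
      fix B x assume B: "B \<subseteq> R" "card B = j" and x: "x \<in> R - B"
      obtain as where as: "set as = B" "distinct as"
        using finite_distinct_list[OF finite_subset[OF B(1) finite_root_set]] by auto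
      obtain cs where l: "length as = j" and co: "cluster_ordering L K f (as @ cs)"
        using start[OF IH _ B as] less.prems by auto
      let ?bs = "as @ cs"
      let ?T = "tower_of L K ?bs"
      have bs: "distinct ?bs" "set ?bs \<subseteq> R" using co unfolding cluster_ordering_iff by blast+
      have "\<exists>l. j < l \<and> l < length ?T \<and> (\<forall>i. j \<le> i \<and> i < l \<longrightarrow> ?T ! i = ?T ! j) \<and>
          ?T ! l \<noteq> ?T ! j \<and> remdups_adj ?T ! Suc j = ?T ! l"
        using tower_strict_start[OF IH _ bs] k less.prems l len[OF co]
        by (intro remdups_adj_first_change) (auto simp: length_tower_of)
      then obtain l' where l': "j < l'" "l' < length ?T" "\<forall>i. j \<le> i \<and> i < l' \<longrightarrow> ?T ! i = ?T ! j"
          "?T ! l' \<noteq> ?T ! j" "remdups_adj ?T ! Suc j = ?T ! l'"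
        by blast
      \<comment> \<open>\<open>m\<close> is the last index before the tower leaves K(B). It is not
        yet known to be \<open>j\<close>, since roots listed after \<open>B\<close> could lie in
        K(B).\<close>
      define m where "m = l' - 1"
      have "Suc m = l'" "j \<le> m" "m < l'" using l'(1) unfolding m_def by auto
      then have m: "Suc m < length ?T" "?T ! m = ?T ! j" "?T ! Suc m \<noteq> ?T ! j"
          "remdups_adj ?T ! Suc j = ?T ! Suc m"
        using l'(2-5) by blast+
      have ml: "m < length ?bs" using m(1) by (simp add: length_tower_of)
      let ?y = "?bs ! m"
      have y: "?y \<in> R" using nth_mem[OF ml] bs(2) by blast
      have M: "set (take m ?bs) \<subseteq> R" using bs(2) set_take_subset[of m ?bs] by blast
      have Tj: "?T ! j = adj B" using l as(1) by (simp add: tower_of_nth)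
      have eqM: "adj (set (take m ?bs)) = adj B" using m(2) ml Tj by (simp add: tower_of_nth)
      have "?T ! Suc m = adj (insert ?y (set (take m ?bs)))"
        using tower_of_nth_Suc[OF ml] .
      then have TS: "?T ! Suc m = adj (insert ?y B)" using adj_insert_cong[OF M B(1) y eqM] by simp
      have yB: "?y \<in> R - B"
        using y m(3) TS Tj by (auto simp: insert_absorb)
      have "dimension (falling_factorial (card R) j * card (orb B ?y)) K (adj (insert ?y B))"
        using dimension_adj_insert[OF B(1) y dimension_adj[OF IH B]] .
      then have "ring.dim L K (?T ! Suc m) = falling_factorial (card R) j * card (orb B ?y)"
        using dimI[OF subfield_axioms] unfolding TS over_def by blast
      moreover have "ring.dim L K (?T ! Suc m) = falling_factorial (card R) j * (card R - j)"
        using nth[OF co less.prems] m(4) by (simp add: falling_factorial_Suc)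
      \<comment> \<open>The common factor, the degree of K(B), is positive and cancels.\<close>
      ultimately have "card (orb B ?y) = card R - j"
        using falling_factorial_pos[of j "card R"] less.prems k by simp
      then have "card (orb B ?y) = card (R - B)"
        using card_Diff_subset[OF finite_subset[OF B(1) finite_root_set] B(1)] B(2) by simp
      then show "orb B x = R - B" using orb_eq_if_large_orb[OF B(1) yB _ x] by blast
    qed
  qed
  have "adj B = N" if B: "B \<subseteq> R" "card B = k" for B
  proof -
    obtain as where as: "set as = B" "distinct as"
      using finite_distinct_list[OF finite_subset[OF B(1) finite_root_set]] by auto
    obtain cs where l: "length as = k" and co: "cluster_ordering L K f (as @ cs)"
      using start[OF _ le_refl B as] q by auto
    let ?T = "tower_of L K (as @ cs)"
    have bs: "distinct (as @ cs)" "set (as @ cs) \<subseteq> R" using co unfolding cluster_ordering_iff by blast+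
    \<comment> \<open>All k + 1 distinct fields have appeared by index k, where the tower has
      reached K(B); so its last field \<open>N\<close> equals K(B).\<close>
    have "?T ! length (as @ cs) = ?T ! k"
      using tower_strict_start[OF _ k bs] q l len[OF co]
      by (intro remdups_adj_eventually_const) (auto simp: length_tower_of)
    then show ?thesis
      using cluster_ordering_generates[OF co] l as(1) by (simp add: tower_of_nth)
  qed
  then show ?thesis unfolding strict_towers_def using q by blast
qed

section \<open>Shape and number of the towers under \<open>strict_towers\<close>\<close>

context
  fixes k
  assumes st: "strict_towers k" and k0: "0 < k" and k: "k < card R"
begin

text \<open>For k = 1 each root generates \<open>N\<close>, so there is one cluster. For k \<ge> 2
  the field K(b) contains no root but b, so clusters are singletons.\<close>

lemma length_cluster_ordering:
  assumes co: "cluster_ordering L K f bs"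
  shows "length bs = (if k = 1 then 1 else card R)"
proof -
  have bs: "distinct bs" "set bs \<subseteq> R" and ex: "\<And>x. x \<in> R \<Longrightarrow> \<exists>!b. b \<in> set bs \<and> adj {b} = adj {x}"
    using co unfolding cluster_ordering_iff by blast+
  show ?thesis
  proof (cases "k = 1")
    case True
    have N1: "adj {x} = N" if "x \<in> R" for x
      using st that True unfolding strict_towers_def by simp
    obtain x where x: "x \<in> R" using k by fastforce
    then obtain b where b: "b \<in> set bs" "adj {b} = adj {x}" using ex by blast
    have "c = b" if "c \<in> set bs" for c
      using ex[OF x] b that N1 bs(2) x by (metis subsetD)
    then have "set bs = {b}" using b(1) by blast
    then show ?thesis using True bs(1) distinct_card by fastforce
  next
    case False
    have "x \<in> set bs" if x: "x \<in> R" for x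
    proof -
      obtain b where b: "b \<in> set bs" "adj {b} = adj {x}" using ex[OF x] by blast
      have "adj {b} \<inter> R = {b}"
        using adj_Int_roots[of 1 "{b}"] st False k k0 b(1) bs(2) unfolding strict_towers_def by auto
      then have "x = b" using b(2) x adjoin_incl(2)[of "{x}" L K] by auto
      then show ?thesis using b(1) by simp
    qed
    then have "set bs = R" using bs(2) by blast
    then show ?thesis using False bs(1) distinct_card by fastforce
  qed
qed

lemma le_length_cluster_ordering: "cluster_ordering L K f bs \<Longrightarrow> k \<le> length bs"
  using length_cluster_ordering k k0 by auto

lemma tower_end:
  assumes co: "cluster_ordering L K f bs" and i: "k \<le> i" "i \<le> length bs"
  shows "tower_of L K bs ! i = N"
proof -
  have bs: "distinct bs" "set bs \<subseteq> R" using co unfolding cluster_ordering_iff by blast+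
  have tk: "set (take k bs) \<subseteq> R" "set (take i bs) \<subseteq> R"
    using bs(2) set_take_subset[of k bs] set_take_subset[of i bs] by blast+
  have "card (set (take k bs)) = k" using bs i by (simp add: distinct_card)
  then have "adj (set (take k bs)) = N" using st tk unfolding strict_towers_def by blast
  then show ?thesis
    using adj_prefix_mono[OF bs(2) i(1)] adj_le_N[OF tk(2)] i(2) by (simp add: tower_of_nth)
qed

text \<open>The tower grows strictly for k steps and equals \<open>N\<close> from index k on, so
  dropping repetitions keeps exactly its first k + 1 entries.\<close>

lemma strict_towers_shape:
  assumes T: "T \<in> cluster_towers L K f"
  shows "tower_length T = k" and "tower_degrees L K T = map (falling_factorial (card R)) [1..<Suc k]"
proof -
  obtain bs where co: "cluster_ordering L K f bs" and Teq: "T = tower_of L K bs"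
    using T unfolding cluster_towers_def by auto
  have bs: "distinct bs" "set bs \<subseteq> R" using co unfolding cluster_ordering_iff by blast+
  have kl: "k \<le> length bs" using le_length_cluster_ordering[OF co] .
  have q: "\<forall>i<k. fixer_transitive i" using st unfolding strict_towers_def by blast
  have strict: "T ! i \<noteq> T ! Suc i" if "i < k" for i
    using tower_strict_start[OF q k bs kl that] unfolding Teq .
  have const: "T ! i = N" if "k \<le> i" "i < length T" for i
    using tower_end[OF co, of i] that unfolding Teq length_tower_of by simp
  have "{i. Suc i < length T \<and> T ! i \<subset> T ! Suc i} = {..<k}"
  proof (intro equalityI subsetI)
    fix i assume i: "i \<in> {i. Suc i < length T \<and> T ! i \<subset> T ! Suc i}"
    then have "\<not> k \<le> i" using const[of i] const[of "Suc i"] by auto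
    then show "i \<in> {..<k}" by simp
  next
    fix i assume i: "i \<in> {..<k}"
    then have "T ! i \<subseteq> T ! Suc i"
      using adj_prefix_mono[OF bs(2), of i "Suc i"] kl unfolding Teq by (simp add: tower_of_nth)
    then show "i \<in> {i. Suc i < length T \<and> T ! i \<subset> T ! Suc i}"
      using strict[of i] i kl unfolding Teq length_tower_of by auto
  qed
  then show "tower_length T = k" unfolding tower_length_def by simp
  have "remdups_adj T = take (Suc k) T"
  proof (rule remdups_adj_eq_take[OF _ strict])
    show kT: "k < length T" using kl unfolding Teq length_tower_of by simp
    show "T ! i = T ! k" if "k \<le> i" "i < length T" for i
      using const[OF that] const[OF le_refl kT] by simp
  qed
  then have "tower_degrees L K T = map (\<lambda>E. ring.dim L K E) (tl (take (Suc k) T))"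
    unfolding tower_degrees_def by simp
  also have "\<dots> = map (falling_factorial (card R)) [1..<Suc k]"
  proof (rule nth_equalityI)
    show l: "length (map (\<lambda>E. ring.dim L K E) (tl (take (Suc k) T))) = length (map (falling_factorial (card R)) [1..<Suc k])"
      using kl unfolding Teq by (simp add: length_tower_of)
    fix i assume "i < length (map (\<lambda>E. ring.dim L K E) (tl (take (Suc k) T)))"
    then have i: "i < k" using l by simp
    have tk: "set (take (Suc i) bs) \<subseteq> R" using bs(2) set_take_subset[of "Suc i" bs] by blast
    have c: "card (set (take (Suc i) bs)) = Suc i" using bs i kl by (simp add: distinct_card)
    have "\<forall>j<Suc i. fixer_transitive j" using q i by simp
    from dimI[OF subfield_axioms dimension_adj[OF this tk c]]
    have "ring.dim L K (T ! Suc i) = falling_factorial (card R) (Suc i)"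
      using i kl unfolding Teq over_def by (simp add: tower_of_nth)
    moreover have "tl (take (Suc k) T) ! i = T ! Suc i" using i kl unfolding Teq by (subst nth_tl) (auto simp: length_tower_of)
    ultimately show "map (\<lambda>E. ring.dim L K E) (tl (take (Suc k) T)) ! i = map (falling_factorial (card R)) [1..<Suc k] ! i"
      using i kl l by (simp add: nth_append del: upt_Suc)
  qed
  finally show "tower_degrees L K T = map (falling_factorial (card R)) [1..<Suc k]" .
qed

text \<open>The first \<open>k - 1\<close> roots of a cluster ordering determine its tower and can be read off it.\<close>

lemma card_cluster_towers: "card (cluster_towers L K f) = falling_factorial (card R) (k - 1)"
proof -
  define m where "m = k - 1"
  have m: "m < k" "k = Suc m" using k0 unfolding m_def by auto
  \<comment> \<open>The common length of all cluster orderings; towers have one entry more because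
    they start with \<open>K\<close>.\<close>
  define c :: nat where "c = (if k = 1 then 1 else card R)"
  \<comment> \<open>The tower rebuilt from \<open>m = k - 1\<close> roots: indices 0 to m are the
    fields of their prefixes, and the remaining \<open>Suc c - k\<close> entries are
    \<open>N\<close>.\<close>
  define \<Phi> where "\<Phi> as = map (\<lambda>i. adj (set (take i as))) [0..<k] @ replicate (Suc c - k) N" for as
  let ?A = "{as. length as = m \<and> distinct as \<and> set as \<subseteq> R}"
  have kc: "k \<le> c" using k k0 unfolding c_def by auto
  have q: "\<forall>i<m. fixer_transitive i" "\<forall>i<k. fixer_transitive i"
    using st m unfolding strict_towers_def by auto
  have tower: "tower_of L K bs = \<Phi> (take m bs)" if co: "cluster_ordering L K f bs" for bs
  proof (rule nth_equalityI)
    have lb: "length bs = c" using length_cluster_ordering[OF co] unfolding c_def .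
    show "length (tower_of L K bs) = length (\<Phi> (take m bs))"
      using lb kc unfolding \<Phi>_def by (simp add: length_tower_of)
    fix i assume "i < length (tower_of L K bs)"
    then have i: "i \<le> length bs" by (simp add: length_tower_of)
    show "tower_of L K bs ! i = \<Phi> (take m bs) ! i"
    proof (cases "i < k")
      case True
      then have "min i m = i" using m by simp
      then show ?thesis using True i unfolding \<Phi>_def by (simp add: nth_append tower_of_nth)
    next
      case False
      then show ?thesis using tower_end[OF co _ i] i lb kc unfolding \<Phi>_def by (simp add: nth_append)
    qed
  qed
  have "cluster_towers L K f = \<Phi> ` ?A"
  proof (intro equalityI subsetI)
    fix T assume "T \<in> cluster_towers L K f"
    then obtain bs where co: "cluster_ordering L K f bs" and T: "T = tower_of L K bs"
      unfolding cluster_towers_def by auto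
    have "take m bs \<in> ?A"
      using co le_length_cluster_ordering[OF co] m set_take_subset[of m bs] unfolding cluster_ordering_iff by auto
    then show "T \<in> \<Phi> ` ?A" using tower[OF co] T by blast
  next
    fix T assume "T \<in> \<Phi> ` ?A"
    then obtain as where as: "length as = m" "distinct as" "set as \<subseteq> R" and T: "T = \<Phi> as" by blast
    have "card (set as) = m" using as distinct_card by fastforce
    then obtain cs where co: "cluster_ordering L K f (as @ cs)"
      using cluster_ordering_exists[OF as(2,3)] roots_inequivalent[OF q(1) _ as(3)] m k by (metis less_trans)
    then have "T = tower_of L K (as @ cs)" using tower[OF co] T as(1) by simp
    then show "T \<in> cluster_towers L K f" using co unfolding cluster_towers_def by blast
  qed
  moreover have "inj_on \<Phi> ?A"
  proof (rule inj_onI)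
    fix as bs assume as: "as \<in> ?A" and bs: "bs \<in> ?A" and eq: "\<Phi> as = \<Phi> bs"
    show "as = bs"
    proof (rule eq_if_prefix_sets_eq)
      show "length as = length bs" "distinct as" "distinct bs" using as bs by auto
      fix i assume i: "i \<le> length as"
      then have ik: "i < k" using as m by simp
      have "adj (set (take i as)) = adj (set (take i bs))"
        using arg_cong[OF eq, of "\<lambda>xs. xs ! i"] ik unfolding \<Phi>_def by (simp add: nth_append)
      \<comment> \<open>The roots inside the i-th field are exactly the first i roots, as i < k < n
        leaves at least two others. This decodes the tower.\<close>
      moreover have "adj (set (take i cs)) \<inter> R = set (take i cs)" if cs: "cs \<in> ?A" for cs
      proof (rule adj_Int_roots)
        show "fixer_transitive i" "Suc i < card R" using q(2) ik k by auto
        show "set (take i cs) \<subseteq> R" using cs set_take_subset[of i cs] by auto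
        show "card (set (take i cs)) = i" using cs i as by (simp add: distinct_card)
      qed
      ultimately show "set (take i as) = set (take i bs)" using as bs by metis
    qed
  qed
  ultimately have "card (cluster_towers L K f) = card ?A" by (simp add: card_image)
  also have "\<dots> = falling_factorial (card R) m"
    using card_distinct_lists[OF finite_root_set, of m] m k by simp
  finally show ?thesis unfolding m_def .
qed

end

end

theorem theorem3p10:
  fixes L :: "('a, 'b) ring_scheme" and K :: "'a set" and f :: "'a list" and n k :: nat
  assumes "algebraic_closure L K"
    and "perfect_in L K"
    and "f \<in> carrier (K[X]\<^bsub>L\<^esub>)"
    and "pirreducible\<^bsub>L\<^esub> K f"
    and "degree f = n"
    and "n > 2"
    and "k > 0"
    and "k < n"
  shows "let G = galois_group L K (splitting_field L K f);
             cond1 =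
               (\<forall>B. minimal_generating_set L K f B \<longrightarrow> card B = k) \<and>
               (\<forall>B. B \<subseteq> root_set L f \<and> card B = k \<longrightarrow> minimal_generating_set L K f B);
             cond2 =
               (\<forall>T \<in> cluster_towers L K f.
                  tower_length T = k \<and>
                  tower_degrees L K T = map (falling_factorial n) [1..<Suc k])
         in (sharply_transitive_on k G (root_set L f) \<longleftrightarrow> cond1 \<and> cond2) \<and>
            (cond1 \<longrightarrow> card {B. minimal_generating_set L K f B} = n choose k) \<and>
            (cond2 \<longrightarrow> card (cluster_towers L K f) = falling_factorial n (k - 1))"
proof -
  interpret algebraic_closure L K using assms(1) .
  interpret separable_splitting L K f
  proof
    show "f \<in> carrier (K[X]\<^bsub>L\<^esub>)" using assms(3) .
    show "f \<noteq> []" using assms(5,6) by auto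
    show "\<And>x. x \<in> carrier L \<Longrightarrow> alg_mult f x \<le> 1"
      using assms(2-4) unfolding perfect_in_def by blast
  qed
  \<comment> \<open>All roots are simple, so their number is the degree.\<close>
  have n: "card (root_set L f) = n" using card_root_set assms(5) by simp
  have kR: "k < card (root_set L f)" using n assms(8) by simp
  define cond1 where "cond1 \<longleftrightarrow> (\<forall>B. minimal_generating_set L K f B \<longrightarrow> card B = k) \<and>
               (\<forall>B. B \<subseteq> root_set L f \<and> card B = k \<longrightarrow> minimal_generating_set L K f B)"
  define cond2 where "cond2 \<longleftrightarrow> (\<forall>T \<in> cluster_towers L K f. tower_length T = k \<and>
                  tower_degrees L K T = map (falling_factorial n) [1..<Suc k])"
  have 1: "strict_towers k \<Longrightarrow> cond1"
    using minimal_generating_sets[OF _ kR] unfolding cond1_def by blast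
  have 2: "cond2 \<longleftrightarrow> strict_towers k"
    using strict_towers_shape[OF _ assms(7) kR] degrees_imp_strict_towers[OF _ kR] n
    unfolding cond2_def by auto
  have "card {B. minimal_generating_set L K f B} = n choose k" if cond1
  proof -
    have "{B. minimal_generating_set L K f B} = {B. B \<subseteq> root_set L f \<and> card B = k}"
      using that unfolding cond1_def minimal_generating_set_def by blast
    then show ?thesis using n_subsets[OF finite_root_set] n by simp
  qed
  moreover have "cond2 \<Longrightarrow> card (cluster_towers L K f) = falling_factorial n (k - 1)"
    using card_cluster_towers[OF _ assms(7) kR] 2 n by simp
  moreover have "sharply_transitive_on k (galois_group L K (splitting_field L K f)) (root_set L f) \<longleftrightarrow>
      cond1 \<and> cond2"
    using sharply_transitive_iff[OF less_imp_le[OF kR]] 1 2 by blast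
  ultimately show ?thesis unfolding Let_def cond1_def cond2_def by blast
qed

end
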